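(* Let $\ell:\mathbb{N}\to\mathbb{N}$ satisfy $\ell(n)=o\!\left(\frac{n}{\log n}\right)$. Then, for any $\ell$-index-based pivot rule $\Pi^{P}$, there exists a family $(\mathrm{LP}_n)_{n\in\mathbb{N}}$ of linear programs, where $\mathrm{LP}_n$ has $n$ variables and $m\le n$ equality constraints, such that the simplex method with pivot rule $\Pi^{P}$ requires $n^{\omega(1)}$ (i.e. superpolynomially many in $n$) iterations to find the optimal basis.
   Context: Linear programs are of the form $\max\, c^\top x$ s.t. $Ax=b$, $x\ge 0$, with $A\in\mathbb{Q}^{m\times n}$ of full row rank, $b\in\mathbb{Q}^m$, $c\in\mathbb{Q}^n$; they are assumed feasible and bounded, and the simplex method is given an initial feasible basis. A basis is a set $B\subseteq[n]=\{1,\dots,n\}$ of $m$ indices of linearly independent columns of $A$; it is feasible if the unique $x$ with $Ax=b$ and $x_i=0$ for $i\notin B$ satisfies $x\ge0$. The reduced cost of $i$ is $\mathrm{rc}(i)=c_i-c_B^\top A_{\cdot B}^{-1}A_{\cdot i}$, and $\Gamma^+(B)=\{i\in[n]\setminus B:\mathrm{rc}(i)>0\}$ is the set of improving indices. An iteration of the simplex method picks an entering index $i\in\Gamma^+(B)$ and a leaving index $j\in B$ such that $B\cup\{i\}\setminus\{j\}$ is a feasible basis and moves to it; it stops at a basis with $\Gamma^+(B)=\emptyset$ (optimal basis). In non-degenerate programs the leaving index is uniquely determined by the entering index. Given $\ell:\mathbb{N}\to\mathbb{N}$, an $\ell$-index-selector function is a function $P:\mathbb{N}^3\to\mathbb{N}^2$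 with $P(k,n,h)\in\{1,\dots,k\}\times\{1,\dots,\ell(n)\}$ for all $k,n,h$. It induces the $\ell$-index-based pivot rule $\Pi^P$, which has memory states $\{1,\dots,\ell(n)\}$, starts in memory state $1$, and acts as follows: on a program with $n$ variables at feasible non-optimal basis $B$ in memory state $h$, if $P(|\Gamma^+(B)|,n,h)=(i',h')$, then the entering index is the $i'$-th smallest index of $\Gamma^+(B)$ and the memory state becomes $h'$. *)

theory Defs
  imports Complex_Main "HOL-Library.Landau_Symbols"
begin

text \<open>A linear program  max c^T x  s.t.  A x = b, x \<ge> 0  with n variables (columns
  indexed 0..<n, preserving the order of [n]) and m equality constraints (rows 0..<m).
  Entries outside these ranges are irrelevant.\<close>
record lp =
  nvars :: nat
  ncons :: nat
  mat :: "nat \<Rightarrow> nat \<Rightarrow> rat"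
  rhs :: "nat \<Rightarrow> rat"
  obj :: "nat \<Rightarrow> rat"

definition full_row_rank :: "lp \<Rightarrow> bool" where
  "full_row_rank L \<longleftrightarrow> (\<forall>y :: nat \<Rightarrow> rat.
     (\<forall>j<nvars L. (\<Sum>i<ncons L. y i * mat L i j) = 0) \<longrightarrow> (\<forall>i<ncons L. y i = 0))"

definition feasible_point :: "lp \<Rightarrow> (nat \<Rightarrow> rat) \<Rightarrow> bool" where
  "feasible_point L x \<longleftrightarrow>
     (\<forall>i<ncons L. (\<Sum>j<nvars L. mat L i j * x j) = rhs L i) \<and> (\<forall>j<nvars L. x j \<ge> 0)"

definition lp_bounded :: "lp \<Rightarrow> bool" where
  "lp_bounded L \<longleftrightarrow> (\<exists>M. \<forall>x. feasible_point L x \<longrightarrow> (\<Sum>j<nvars L. obj L j * x j) \<le> M)"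

definition is_basis :: "lp \<Rightarrow> nat set \<Rightarrow> bool" where
  "is_basis L B \<longleftrightarrow> B \<subseteq> {..<nvars L} \<and> card B = ncons L \<and>
     (\<forall>y :: nat \<Rightarrow> rat. (\<forall>i<ncons L. (\<Sum>j\<in>B. mat L i j * y j) = 0) \<longrightarrow> (\<forall>j\<in>B. y j = 0))"

definition basic_sol :: "lp \<Rightarrow> nat set \<Rightarrow> nat \<Rightarrow> rat" where
  "basic_sol L B = (THE x. (\<forall>i<ncons L. (\<Sum>j<nvars L. mat L i j * x j) = rhs L i)
                          \<and> (\<forall>j. j \<notin> B \<longrightarrow> x j = 0))"

definition feasible_basis :: "lp \<Rightarrow> nat set \<Rightarrow> bool" where
  "feasible_basis L B \<longleftrightarrow> is_basis L B \<and> (\<forall>j<nvars L. basic_sol L B j \<ge> 0)"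

definition basis_coords :: "lp \<Rightarrow> nat set \<Rightarrow> nat \<Rightarrow> nat \<Rightarrow> rat" where
  "basis_coords L B i = (THE d. (\<forall>k<ncons L. (\<Sum>j\<in>B. mat L k j * d j) = mat L k i)
                               \<and> (\<forall>j. j \<notin> B \<longrightarrow> d j = 0))"

definition reduced_cost :: "lp \<Rightarrow> nat set \<Rightarrow> nat \<Rightarrow> rat" where
  "reduced_cost L B i = obj L i - (\<Sum>j\<in>B. obj L j * basis_coords L B i j)"

definition improving :: "lp \<Rightarrow> nat set \<Rightarrow> nat set" where
  "improving L B = {i \<in> {..<nvars L} - B. reduced_cost L B i > 0}"

definition valid_lp :: "lp \<Rightarrow> nat set \<Rightarrow> bool" where
  "valid_lp L B0 \<longleftrightarrow> full_row_rank L \<and> ncons L \<le> nvars L \<and> feasible_basis L B0 \<and> lp_bounded L"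

text \<open>ell-index-selector function (curried); the constraint is required whenever k \<ge> 1,
  the only case in which it is ever used (for k = 0 the set {1..k} is empty).\<close>
definition index_selector :: "(nat \<Rightarrow> nat) \<Rightarrow> (nat \<Rightarrow> nat \<Rightarrow> nat \<Rightarrow> nat \<times> nat) \<Rightarrow> bool" where
  "index_selector ell P \<longleftrightarrow> (\<forall>k n h. k \<ge> 1 \<longrightarrow>
      fst (P k n h) \<in> {1..k} \<and> snd (P k n h) \<in> {1..ell n})"

text \<open>One iteration of the simplex method with pivot rule Pi^P, on states (basis, memory).\<close>
definition pivot_step :: "lp \<Rightarrow> (nat \<Rightarrow> nat \<Rightarrow> nat \<Rightarrow> nat \<times> nat)
    \<Rightarrow> nat set \<times> nat \<Rightarrow> nat set \<times> nat \<Rightarrow> bool" where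
  "pivot_step L P s s' \<longleftrightarrow>
     (let B = fst s; h = snd s; \<Gamma> = improving L B;
          (i', h') = P (card \<Gamma>) (nvars L) h;
          i = sorted_list_of_set \<Gamma> ! (i' - 1)
      in \<Gamma> \<noteq> {} \<and> snd s' = h' \<and>
         (\<exists>j\<in>B. fst s' = insert i B - {j} \<and> feasible_basis L (fst s')))"

definition simplex_run :: "lp \<Rightarrow> (nat \<Rightarrow> nat \<Rightarrow> nat \<Rightarrow> nat \<times> nat) \<Rightarrow> nat set
    \<Rightarrow> (nat \<Rightarrow> nat set \<times> nat) \<Rightarrow> nat \<Rightarrow> bool" where
  "simplex_run L P B0 ss t \<longleftrightarrow> ss 0 = (B0, 1) \<and>
     (\<forall>k<t. pivot_step L P (ss k) (ss (Suc k))) \<and> improving L (fst (ss t)) = {}"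

end

theory Submission
  imports Defs
begin

text \<open>
  The program is a Klee--Minty cube of dimension \<open>D\<close> whose lowest coordinate is the height function of a
  polygon with a chain of \<open>N\<close> steps. Each of the \<open>2\<^sup>D\<close> vertices of the cube contributes a lap along the
  chain, alternately upwards and downwards, followed by a pivot at the lowest improving coordinate, which
  decrements a binary counter.

  Dummy columns, whose reduced cost is an arbitrary affine function of the dual solution, keep the number
  \<open>K\<close> of improving indices constant along this path. Then the memory states form the orbit of a single
  self-map of \<open>{1..\<ell>(n)}\<close>, which is eventually periodic, and \<open>N + 1\<close> is chosen to be a multiple of the period
  exceeding the preperiod. So the rank demanded by the rule depends only on the position within the
  lap, on its direction, and on whether it is the first lap. These are detected by signs of affine
  functions of the dual solution, so dummies can be inserted in front of the desired column to give it
  precisely the demanded rank. Neither \<open>N\<close> nor the number of dummies exceeds a constant multiple of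
  \<open>\<ell>(n) + D\<close>, which permits \<open>D = n div 100\<close>.\<close>

section \<open>Simplex bases\<close>

text \<open>Gaussian elimination by induction on the columns: the pivot row \<open>r0\<close> is
  removed, the reduced system \<open>a'\<close> inherits injectivity, and its solution extends by
  back substitution. Existence of basic solutions rests on this.\<close>

lemma injective_square_system_solvable:
  fixes a :: "'r \<Rightarrow> 'c \<Rightarrow> 'f::field"
  assumes "finite R" "finite C" "card R = card C"
    and "\<And>x. (\<forall>r\<in>R. (\<Sum>c\<in>C. a r c * x c) = 0) \<Longrightarrow> \<forall>c\<in>C. x c = 0"
  shows "\<exists>x. \<forall>r\<in>R. (\<Sum>c\<in>C. a r c * x c) = v r"
  using assms(2,1,3,4)
proof (induction C arbitrary: R a v rule: finite_induct)
  case empty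
  then show ?case by simp
next
  case (insert c C)
  have "\<exists>r\<in>R. a r c \<noteq> 0"
  proof (rule ccontr)
    assume "\<not> ?thesis"
    hence "\<forall>r\<in>R. (\<Sum>d\<in>insert c C. a r d * (if d = c then 1 else 0)) = 0"
      using insert.hyps by (auto intro!: sum.neutral)
    from insert.prems(3)[OF this] show False by simp
  qed
  then obtain r0 where r0: "r0 \<in> R" "a r0 c \<noteq> 0" by blast
  define a' where "a' r d = a r d - a r c * a r0 d / a r0 c" for r d
  define v' where "v' r = v r - a r c * v r0 / a r0 c" for r
  \<comment> \<open>\<open>ext w x\<close> keeps \<open>x\<close> on \<open>C\<close> and sets
    coordinate \<open>c\<close> so that row \<open>r0\<close> takes the value \<open>w\<close>. The
    choice \<open>w = 0\<close> transfers injectivity, \<open>w = v r0\<close> yields the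
    solution.\<close>
  define ext where "ext w x = x(c := (w - (\<Sum>d\<in>C. a r0 d * x d)) / a r0 c)" for w x
  have ext0: "(\<Sum>d\<in>insert c C. a r0 d * ext w x d) = w" for w x
  proof -
    have "(\<Sum>d\<in>C. a r0 d * ext w x d) = (\<Sum>d\<in>C. a r0 d * x d)"
      using insert.hyps by (intro sum.cong) (auto simp: ext_def)
    then show ?thesis using insert.hyps r0 by (simp add: ext_def)
  qed
  have extr: "(\<Sum>d\<in>insert c C. a r d * ext w x d) = (\<Sum>d\<in>C. a' r d * x d) + a r c * w / a r0 c"
    for r w x
  proof -
    have "(\<Sum>d\<in>C. a r d * ext w x d) = (\<Sum>d\<in>C. a r d * x d)"
      using insert.hyps by (intro sum.cong) (auto simp: ext_def)
    moreover have "(\<Sum>d\<in>C. a' r d * x d)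
        = (\<Sum>d\<in>C. a r d * x d) - a r c / a r0 c * (\<Sum>d\<in>C. a r0 d * x d)"
      by (simp add: a'_def sum_distrib_left sum_subtractf algebra_simps)
    ultimately show ?thesis using insert.hyps r0 by (simp add: ext_def field_simps)
  qed
  have "\<exists>x. \<forall>r\<in>R - {r0}. (\<Sum>d\<in>C. a' r d * x d) = v' r"
  proof (rule insert.IH)
    show "card (R - {r0}) = card C" using insert r0 by simp
    fix x assume x: "\<forall>r\<in>R - {r0}. (\<Sum>d\<in>C. a' r d * x d) = 0"
    have "\<forall>r\<in>R. (\<Sum>d\<in>insert c C. a r d * ext 0 x d) = 0"
    proof
      fix r assume "r \<in> R"
      then show "(\<Sum>d\<in>insert c C. a r d * ext 0 x d) = 0"
        using ext0[of 0 x] extr[of r 0 x] x by (cases "r = r0") auto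
    qed
    from insert.prems(3)[OF this] show "\<forall>d\<in>C. x d = 0"
      using insert.hyps by (auto simp: ext_def split: if_splits)
  qed (use insert in auto)
  then obtain x where x: "\<forall>r\<in>R - {r0}. (\<Sum>d\<in>C. a' r d * x d) = v' r" by blast
  have "(\<Sum>d\<in>insert c C. a r d * ext (v r0) x d) = v r" if "r \<in> R" for r
    using ext0[of "v r0" x] extr[of r "v r0" x] x that by (cases "r = r0") (auto simp: v'_def)
  then show ?case by blast
qed

lemma is_basis_finite: "is_basis L B \<Longrightarrow> finite B"
  unfolding is_basis_def by (meson finite_lessThan finite_subset)

lemma is_basis_unique_solution:
  assumes "is_basis L B"
  shows "\<exists>!d. (\<forall>k<ncons L. (\<Sum>j\<in>B. mat L k j * d j) = v k) \<and> (\<forall>j. j \<notin> B \<longrightarrow> d j = 0)"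
proof (rule ex_ex1I)
  have fin: "finite B" using assms by (rule is_basis_finite)
  have "\<exists>x. \<forall>k\<in>{..<ncons L}. (\<Sum>j\<in>B. mat L k j * x j) = v k"
    using assms fin by (intro injective_square_system_solvable) (auto simp: is_basis_def)
  then obtain x where "\<forall>k<ncons L. (\<Sum>j\<in>B. mat L k j * x j) = v k" by auto
  then show "\<exists>d. (\<forall>k<ncons L. (\<Sum>j\<in>B. mat L k j * d j) = v k) \<and> (\<forall>j. j \<notin> B \<longrightarrow> d j = 0)"
    by (intro exI[of _ "\<lambda>j. if j \<in> B then x j else 0"]) simp
next
  fix d e
  assume d: "(\<forall>k<ncons L. (\<Sum>j\<in>B. mat L k j * d j) = v k) \<and> (\<forall>j. j \<notin> B \<longrightarrow> d j = 0)"
    and e: "(\<forall>k<ncons L. (\<Sum>j\<in>B. mat L k j * e j) = v k) \<and> (\<forall>j. j \<notin> B \<longrightarrow> e j = 0)"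
  have 0: "\<forall>k<ncons L. (\<Sum>j\<in>B. mat L k j * (d j - e j)) = 0"
    using d e by (simp add: right_diff_distrib sum_subtractf)
  have "(\<forall>k<ncons L. (\<Sum>j\<in>B. mat L k j * z j) = 0) \<Longrightarrow> \<forall>j\<in>B. z j = 0" for z
    using assms by (simp add: is_basis_def)
  from this[of "\<lambda>j. d j - e j", OF 0] have "\<forall>j\<in>B. d j - e j = 0" .
  then have "d j = e j" for j using d e by (cases "j \<in> B") auto
  then show "d = e" ..
qed

lemma sum_nvars_eq_sum_basis:
  fixes f x :: "nat \<Rightarrow> rat"
  assumes "B \<subseteq> {..<nvars L}" "\<forall>j. j \<notin> B \<longrightarrow> x j = 0"
  shows "(\<Sum>j<nvars L. f j * x j) = (\<Sum>j\<in>B. f j * x j)"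
  using assms by (intro sum.mono_neutral_right) auto

lemma basic_sol_props:
  assumes "is_basis L B"
  shows "\<forall>i<ncons L. (\<Sum>j\<in>B. mat L i j * basic_sol L B j) = rhs L i"
    and "\<forall>j. j \<notin> B \<longrightarrow> basic_sol L B j = 0"
proof -
  have B: "B \<subseteq> {..<nvars L}" using assms by (simp add: is_basis_def)
  have "((\<forall>i<ncons L. (\<Sum>j<nvars L. mat L i j * x j) = rhs L i) \<and> (\<forall>j. j \<notin> B \<longrightarrow> x j = 0))
      = ((\<forall>i<ncons L. (\<Sum>j\<in>B. mat L i j * x j) = rhs L i) \<and> (\<forall>j. j \<notin> B \<longrightarrow> x j = 0))" for x
  proof (cases "\<forall>j. j \<notin> B \<longrightarrow> x j = 0")
    case True
    then show ?thesis by (simp add: sum_nvars_eq_sum_basis[OF B True])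
  qed blast
  hence "basic_sol L B = (THE x. (\<forall>i<ncons L. (\<Sum>j\<in>B. mat L i j * x j) = rhs L i)
      \<and> (\<forall>j. j \<notin> B \<longrightarrow> x j = 0))"
    unfolding basic_sol_def by simp
  with theI'[OF is_basis_unique_solution[OF assms, of "rhs L"]]
  show "\<forall>i<ncons L. (\<Sum>j\<in>B. mat L i j * basic_sol L B j) = rhs L i"
    and "\<forall>j. j \<notin> B \<longrightarrow> basic_sol L B j = 0"
    by simp_all
qed

text \<open>Exchanging two sums replaces the coordinates of column \<open>i\<close> in the basis by
  any \<open>y\<close> that prices the basic columns exactly. From here on reduced costs come from
  an explicit dual vector, without inverting a matrix.\<close>

lemma reduced_cost_eq_dual:
  assumes B: "is_basis L B"
    and y: "\<forall>j\<in>B. (\<Sum>k<ncons L. y k * mat L k j) = obj L j"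
  shows "reduced_cost L B i = obj L i - (\<Sum>k<ncons L. y k * mat L k i)"
proof -
  let ?d = "basis_coords L B i"
  have d: "\<forall>k<ncons L. (\<Sum>j\<in>B. mat L k j * ?d j) = mat L k i"
    unfolding basis_coords_def
    using theI'[OF is_basis_unique_solution[OF B, of "\<lambda>k. mat L k i"]] by simp
  have "(\<Sum>j\<in>B. obj L j * ?d j) = (\<Sum>j\<in>B. \<Sum>k<ncons L. y k * mat L k j * ?d j)"
    using y by (simp add: sum_distrib_right[symmetric])
  also have "\<dots> = (\<Sum>k<ncons L. y k * (\<Sum>j\<in>B. mat L k j * ?d j))"
    by (subst sum.swap) (simp add: sum_distrib_left mult.assoc)
  also have "\<dots> = (\<Sum>k<ncons L. y k * mat L k i)" using d by simp
  finally show ?thesis by (simp add: reduced_cost_def)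
qed

text \<open>Weak duality.\<close>

lemma lp_bounded_by_dual:
  assumes "\<forall>j<nvars L. obj L j \<le> (\<Sum>k<ncons L. y k * mat L k j)"
  shows "lp_bounded L"
  unfolding lp_bounded_def
proof (intro exI allI impI)
  fix x assume x: "feasible_point L x"
  have "(\<Sum>j<nvars L. obj L j * x j) \<le> (\<Sum>j<nvars L. (\<Sum>k<ncons L. y k * mat L k j) * x j)"
    using assms x by (intro sum_mono mult_right_mono) (auto simp: feasible_point_def)
  also have "\<dots> = (\<Sum>j<nvars L. \<Sum>k<ncons L. y k * (mat L k j * x j))"
    by (simp add: sum_distrib_right mult.assoc)
  also have "\<dots> = (\<Sum>k<ncons L. y k * (\<Sum>j<nvars L. mat L k j * x j))"
    by (subst sum.swap) (simp add: sum_distrib_left)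
  also have "\<dots> = (\<Sum>k<ncons L. y k * rhs L k)"
    using x by (auto simp: feasible_point_def)
  finally show "(\<Sum>j<nvars L. obj L j * x j) \<le> (\<Sum>k<ncons L. y k * rhs L k)" .
qed

section \<open>A Klee--Minty cube over a polygon\<close>

datatype column = Chain nat | Lo nat | Up nat | Cap | Dummy rat "nat \<Rightarrow> rat"

text \<open>
  Row \<open>i < D\<close> is the Klee--Minty row \<open>Lo i + Up i + 2 (\<Sum>j<i. Lo j) + 2 Chain 0 = 2 N 3\<^sup>i\<^sup>+\<^sup>1\<close>,
  row \<open>D\<close> is \<open>Cap + (sum of the dummies) = 1\<close>, and row \<open>D + N\<close> is \<open>Chain 0 + Chain (N + 1) = 2 N\<close>.
  Row \<open>D + q\<close> with \<open>1 \<le> q < N\<close> says that \<open>Chain (q + 1)\<close> is the slack of a secant of a parabola: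
  in the plane with coordinates \<open>a = Chain 0 / 2\<close> and \<open>b = Chain 1 + a\<close>, it requires
  \<open>Chain k = b - (2 k - 1) a + k (k - 1)\<close>, so \<open>Chain 0, \<dots>, Chain (N + 1)\<close> are the slacks of the
  consecutive edges of a polygon.\<close>

fun coeff :: "nat \<Rightarrow> nat \<Rightarrow> column \<Rightarrow> nat \<Rightarrow> rat" where
  "coeff N D (Chain k) i =
     (if k = 0 then (if i < D then 2 else if i = D then 0 else if i < D + N then of_nat (i - D)
                     else if i = D + N then 1 else 0)
      else if k = 1 then (if D < i \<and> i < D + N then -1 else 0)
      else of_bool (i + 1 = D + k))"
| "coeff N D (Lo j) i = (if i = j then 1 else if j < i \<and> i < D then 2 else 0)"
| "coeff N D (Up j) i = of_bool (i = j)"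
| "coeff N D Cap i = of_bool (i = D)"
| "coeff N D (Dummy c g) i = (if i = D then 1 else g i)"

fun cost :: "column \<Rightarrow> rat" where
  "cost (Chain k) = of_bool (k = 0)"
| "cost (Lo j) = 1"
| "cost (Up j) = 0"
| "cost Cap = 0"
| "cost (Dummy c g) = c"

definition bound :: "nat \<Rightarrow> nat \<Rightarrow> nat \<Rightarrow> rat" where
  "bound N D i =
     (if i < D then 2 * of_nat N * 3 ^ Suc i
      else if i = D then 1
      else if i < D + N then of_nat (i - D) * (of_nat (i - D) + 1)
      else 2 * of_nat N)"

definition column_lp :: "nat \<Rightarrow> nat \<Rightarrow> column list \<Rightarrow> lp" where
  "column_lp N D cs = \<lparr>nvars = length cs, ncons = D + N + 1, mat = \<lambda>i j. coeff N D (cs ! j) i,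
     rhs = bound N D, obj = \<lambda>j. cost (cs ! j)\<rparr>"

lemma column_lp_simps [simp]:
  "nvars (column_lp N D cs) = length cs"
  "ncons (column_lp N D cs) = D + N + 1"
  "mat (column_lp N D cs) = (\<lambda>i j. coeff N D (cs ! j) i)"
  "rhs (column_lp N D cs) = bound N D"
  "obj (column_lp N D cs) = (\<lambda>j. cost (cs ! j))"
  by (simp_all add: column_lp_def)

section \<open>Path vertices, their dual solutions and reduced costs\<close>

definition digit :: "nat \<Rightarrow> nat \<Rightarrow> bool" where
  "digit C j \<longleftrightarrow> odd (C div 2 ^ j)"

definition sign :: "nat \<Rightarrow> nat \<Rightarrow> rat" where
  "sign C j = (if digit C j then 1 else -1)"

text \<open>
  Vertex \<open>\<tau>\<close> of the polygon lies on the edges \<open>\<tau>\<close> and \<open>\<tau> + 1\<close>. The counter \<open>C\<close> lies between \<open>2\<^sup>D\<close> and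
  \<open>2\<^sup>D\<^sup>+\<^sup>1\<close>, so that digit \<open>D\<close> is set; coordinate \<open>j\<close> of the cube is improving iff digit \<open>j\<close> is set, and
  its vertex coordinates are the Gray code of \<open>C\<close>.\<close>

definition vertex_columns :: "nat \<Rightarrow> nat \<Rightarrow> nat \<Rightarrow> nat \<Rightarrow> column set" where
  "vertex_columns N D C \<tau> =
     {Chain k |k. k \<le> N + 1 \<and> k \<noteq> \<tau> \<and> k \<noteq> Suc \<tau>}
     \<union> {Lo j |j. j < D \<and> digit C j \<noteq> digit C (Suc j)}
     \<union> {Up j |j. j < D \<and> digit C j = digit C (Suc j)} \<union> {Cap}"

text \<open>The dual solution at a path vertex. A cube row carries a multiplier only if
  \<open>Up i\<close> is nonbasic, and a polygon row only if its unit slack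
  \<open>Chain \<tau>\<close> or \<open>Chain (Suc \<tau>)\<close> is nonbasic. For
  \<open>2 \<le> \<tau> < N\<close> the two opposite multipliers cancel on \<open>Chain 1\<close>;
  at \<open>\<tau> = N\<close> the top row alone is used.\<close>

definition dual :: "nat \<Rightarrow> nat \<Rightarrow> nat \<Rightarrow> nat \<Rightarrow> nat \<Rightarrow> rat" where
  "dual N D C \<tau> i =
     (if i < D then (sign C (Suc i) - sign C i) / 2
      else if i = D then 0
      else sign C 0 * (of_bool (i = D + \<tau>) - of_bool (i + 1 = D + \<tau> \<and> \<tau> < N)))"

definition rcost :: "nat \<Rightarrow> nat \<Rightarrow> nat \<Rightarrow> nat \<Rightarrow> column \<Rightarrow> rat" where
  "rcost N D C \<tau> c = cost c - (\<Sum>i<D + N + 1. dual N D C \<tau> i * coeff N D c i)"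

lemma sum_rows_split:
  fixes f :: "nat \<Rightarrow> rat"
  shows "(\<Sum>i<D + N + 1. f i) = (\<Sum>i<D. f i) + f D + (\<Sum>q=1..N. f (D + q))"
proof (induction N)
  case (Suc N)
  then show ?case by (simp add: add.assoc)
qed simp

lemma sum_of_bool_eq:
  fixes h :: "nat \<Rightarrow> rat"
  shows "(\<Sum>q=1..N. of_bool (q = a) * h q) = (if 1 \<le> a \<and> a \<le> N then h a else 0)"
proof -
  have "(\<Sum>q=1..N. of_bool (q = a) * h q) = (\<Sum>q=1..N. if q = a then h q else 0)"
    by (intro sum.cong) auto
  then show ?thesis by simp
qed

text \<open>At most two rows beyond row \<open>D\<close> carry a multiplier. For
  \<open>\<tau> = 1\<close> the second would be row \<open>D\<close> itself, whose multiplier is 0;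
  hence the guard \<open>2 \<le> \<tau>\<close>.\<close>

lemma rcost_eq:
  assumes "\<tau> \<le> N"
  shows "rcost N D C \<tau> c = cost c
     - (\<Sum>i<D. (sign C (Suc i) - sign C i) / 2 * coeff N D c i)
     - sign C 0 * ((if 1 \<le> \<tau> then coeff N D c (D + \<tau>) else 0)
         - (if 2 \<le> \<tau> \<and> \<tau> < N then coeff N D c (D + (\<tau> - 1)) else 0))"
proof -
  have "(\<Sum>q=1..N. dual N D C \<tau> (D + q) * coeff N D c (D + q))
      = (\<Sum>q=1..N. sign C 0 * (of_bool (q = \<tau>) * coeff N D c (D + q)
          - of_bool (q = \<tau> - 1) * (of_bool (\<tau> < N) * coeff N D c (D + q))))"
    by (intro sum.cong) (auto simp: dual_def algebra_simps)
  also have "\<dots> = sign C 0 * ((\<Sum>q=1..N. of_bool (q = \<tau>) * coeff N D c (D + q))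
      - (\<Sum>q=1..N. of_bool (q = \<tau> - 1) * (of_bool (\<tau> < N) * coeff N D c (D + q))))"
    by (simp only: sum_distrib_left[symmetric] sum_subtractf)
  also have "\<dots> = sign C 0 * ((if 1 \<le> \<tau> then coeff N D c (D + \<tau>) else 0)
         - (if 2 \<le> \<tau> \<and> \<tau> < N then coeff N D c (D + (\<tau> - 1)) else 0))"
    unfolding sum_of_bool_eq using assms by (intro arg_cong2[where f = "(*)"] arg_cong2[where f = "(-)"] refl) auto
  finally have "(\<Sum>q=1..N. dual N D C \<tau> (D + q) * coeff N D c (D + q)) = \<dots>" .
  moreover have "(\<Sum>i<D. dual N D C \<tau> i * coeff N D c i)
      = (\<Sum>i<D. (sign C (Suc i) - sign C i) / 2 * coeff N D c i)"
    by (simp add: dual_def)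
  moreover have "dual N D C \<tau> D = 0" by (simp add: dual_def)
  ultimately show ?thesis unfolding rcost_def sum_rows_split by simp
qed

text \<open>A column with a constant entry in all cube rows from \<open>j\<close> on sees only the
  two end signs. The upper one is fixed wherever \<open>sign C D = 1\<close>.\<close>

lemma sum_sign_telescope:
  "j \<le> D \<Longrightarrow> (\<Sum>i<D. (sign C (Suc i) - sign C i) / 2 * (if j \<le> i then a else 0))
     = a / 2 * (sign C D - sign C j)"
proof (induction D)
  case (Suc D)
  show ?case
  proof (cases "j = Suc D")
    case True
    then have "(\<Sum>i<Suc D. (sign C (Suc i) - sign C i) / 2 * (if j \<le> i then a else 0)) = 0"
      by (intro sum.neutral) auto
    with True show ?thesis by simp
  next
    case False
    with Suc have "j \<le> D" by simp
    with Suc show ?thesis by (simp add: field_simps)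
  qed
qed simp

lemma rcost_Cap: "\<tau> \<le> N \<Longrightarrow> rcost N D C \<tau> Cap = 0"
  by (auto simp: rcost_eq)

lemma rcost_Up:
  assumes "\<tau> \<le> N" "j < D"
  shows "rcost N D C \<tau> (Up j) = (sign C j - sign C (Suc j)) / 2"
proof -
  have "(\<Sum>i<D. (sign C (Suc i) - sign C i) / 2 * coeff N D (Up j) i)
     = (\<Sum>i<D. if i = j then (sign C (Suc i) - sign C i) / 2 else 0)"
    by (intro sum.cong) auto
  also have "\<dots> = (sign C (Suc j) - sign C j) / 2" using assms by simp
  finally have 1: "(\<Sum>i<D. (sign C (Suc i) - sign C i) / 2 * coeff N D (Up j) i) = \<dots>" .
  have 2: "coeff N D (Up j) (D + q) = 0" for q using assms by simp
  show ?thesis unfolding rcost_eq[OF assms(1)] 1 2 by (simp add: field_simps)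
qed

lemma rcost_Lo:
  assumes "\<tau> \<le> N" "j < D" "sign C D = 1"
  shows "rcost N D C \<tau> (Lo j) = (sign C j + sign C (Suc j)) / 2"
proof -
  have "(\<Sum>i<D. (sign C (Suc i) - sign C i) / 2 * coeff N D (Lo j) i)
     = (\<Sum>i<D. (sign C (Suc i) - sign C i) / 2 * (if Suc j \<le> i then 2 else 0)
         + (if i = j then (sign C (Suc i) - sign C i) / 2 else 0))"
    by (intro sum.cong) auto
  also have "\<dots> = 1 - sign C (Suc j) + (sign C (Suc j) - sign C j) / 2"
    unfolding sum.distrib using sum_sign_telescope[of "Suc j" D C 2] assms by simp
  finally have 1: "(\<Sum>i<D. (sign C (Suc i) - sign C i) / 2 * coeff N D (Lo j) i) = \<dots>" .
  have 2: "coeff N D (Lo j) (D + q) = 0" for q using assms by simp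
  show ?thesis unfolding rcost_eq[OF assms(1)] 1 2 by (simp add: field_simps)
qed

text \<open>\<open>Chain \<tau>\<close> enters to move up along edge \<open>Suc \<tau>\<close>, and
  \<open>Chain (Suc \<tau>)\<close> enters to move down along edge \<open>\<tau>\<close>. The parity
  of \<open>C\<close> decides which one improves; the guards end the lap at \<open>N\<close> and at
  \<open>0\<close>.\<close>

lemma rcost_Chain:
  assumes "\<tau> \<le> N" "2 \<le> N" "sign C D = 1" "k \<le> N + 1"
  shows "rcost N D C \<tau> (Chain k)
     = sign C 0 * (of_bool (k = \<tau> \<and> \<tau> < N) - of_bool (k = Suc \<tau> \<and> 0 < \<tau>))"
proof -
  have *: "(\<Sum>i<D. (sign C (Suc i) - sign C i) / 2 * coeff N D (Chain k) i)
     = of_bool (k = 0) * (1 - sign C 0)"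
  proof (cases "k = 0")
    case True
    then show ?thesis using sum_sign_telescope[of 0 D C 2] assms by simp
  next
    case False
    then have "(\<Sum>i<D. (sign C (Suc i) - sign C i) / 2 * coeff N D (Chain k) i) = 0"
      by (intro sum.neutral) auto
    with False show ?thesis by simp
  qed
  consider "k = 0" | "k = 1" | "k \<ge> 2" by linarith
  then show ?thesis
  proof cases
    case 1
    then show ?thesis unfolding rcost_eq[OF assms(1)] * using assms
      by (auto simp: of_nat_diff algebra_simps)
  next
    case 2
    then show ?thesis unfolding rcost_eq[OF assms(1)] * using assms
      by (auto simp: algebra_simps)
  next
    case 3
    then show ?thesis unfolding rcost_eq[OF assms(1)] * using assms
      by (auto simp: algebra_simps)
  qed
qed

lemma rcost_vertex_columns:
  assumes "\<tau> \<le> N" "2 \<le> N" "sign C D = 1" "c \<in> vertex_columns N D C \<tau>"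
  shows "rcost N D C \<tau> c = 0"
  using assms(4) unfolding vertex_columns_def
  by (auto simp: rcost_Cap rcost_Up rcost_Lo rcost_Chain assms) (auto simp: sign_def)

text \<open>A dummy never enters the basis on the path, so it does not influence the geometry, while its
  reduced cost can be prescribed freely among the affine functions of the dual solution.\<close>

definition probe :: "nat \<Rightarrow> nat \<Rightarrow> rat \<Rightarrow> (nat \<Rightarrow> rat) \<Rightarrow> (nat \<Rightarrow> rat) \<Rightarrow> column" where
  "probe N D a \<gamma> f = Dummy (a + (\<Sum>j<D. \<gamma> j) + f 0)
     (\<lambda>i. if i < D then 2 * (\<Sum>j\<le>i. \<gamma> j) + 2 * f 0
          else if i < D + N then - (\<Sum>l=1..i - D. f l - f 0)
          else - (f N - f 0))"

lemma rcost_probe: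
  assumes "\<tau> \<le> N" "sign C D = 1"
  shows "rcost N D C \<tau> (probe N D a \<gamma> f)
     = a + (\<Sum>j<D. \<gamma> j * sign C j) + sign C 0 * f \<tau>"
proof -
  \<comment> \<open>Summation by parts, for which the cube rows of a probe store partial sums of
    \<open>\<gamma>\<close>.\<close>
  have *: "(\<Sum>i<D. (sign C (Suc i) - sign C i) * (\<Sum>j\<le>i. \<gamma> j))
     = sign C D * (\<Sum>j<D. \<gamma> j) - (\<Sum>j<D. \<gamma> j * sign C j)" for D
    by (induction D) (simp_all add: algebra_simps lessThan_Suc_atMost[symmetric])
  have "(\<Sum>i<D. (sign C (Suc i) - sign C i) / 2 * coeff N D (probe N D a \<gamma> f) i)
     = (\<Sum>i<D. (sign C (Suc i) - sign C i) * (\<Sum>j\<le>i. \<gamma> j)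
         + (sign C (Suc i) - sign C i) / 2 * (if 0 \<le> i then 2 * f 0 else 0))"
    by (intro sum.cong) (auto simp: probe_def field_simps)
  also have "\<dots> = (\<Sum>j<D. \<gamma> j) - (\<Sum>j<D. \<gamma> j * sign C j) + f 0 * (1 - sign C 0)"
    unfolding sum.distrib * using sum_sign_telescope[of 0 D C "2 * f 0"] assms by simp
  finally have 1: "(\<Sum>i<D. (sign C (Suc i) - sign C i) / 2 * coeff N D (probe N D a \<gamma> f) i) = \<dots>" .
  \<comment> \<open>Rows store negated partial sums of \<open>f l - f 0\<close>, so the difference
    of two consecutive rows isolates \<open>\<tau>\<close>. At \<open>\<tau> = N\<close> there is a
    single multiplier, so the last row stores its value directly.\<close>
  have 2: "(if 1 \<le> \<tau> then coeff N D (probe N D a \<gamma> f) (D + \<tau>) else 0)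
         - (if 2 \<le> \<tau> \<and> \<tau> < N then coeff N D (probe N D a \<gamma> f) (D + (\<tau> - 1)) else 0) = f 0 - f \<tau>"
  proof -
    consider "\<tau> = 0" | "\<tau> = 1" "\<tau> < N" | "2 \<le> \<tau>" "\<tau> < N" | "1 \<le> \<tau>" "\<tau> = N"
      using assms(1) by linarith
    then show ?thesis
    proof cases
      case 3
      then obtain t where "\<tau> = Suc t" "1 \<le> t" by (cases \<tau>) auto
      with 3 show ?thesis by (simp add: probe_def)
    qed (auto simp: probe_def)
  qed
  show ?thesis unfolding rcost_eq[OF assms(1)] 1 2 by (simp add: probe_def algebra_simps)
qed

section \<open>Nonnegative solutions of the cube system\<close>

definition cube_columns :: "nat \<Rightarrow> nat \<Rightarrow> column set" where
  "cube_columns N D = Chain ` {..N + 1} \<union> Lo ` {..<D} \<union> Up ` {..<D} \<union> {Cap}"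

text \<open>Solutions are indexed by columns instead of positions, because the final list contains
  copies of columns. Dummies are left out of the sum.\<close>

definition cube_solution :: "nat \<Rightarrow> nat \<Rightarrow> (column \<Rightarrow> rat) \<Rightarrow> bool" where
  "cube_solution N D X \<longleftrightarrow> (\<forall>c. X c \<ge> 0) \<and>
     (\<forall>i<D + N + 1. (\<Sum>c\<in>cube_columns N D. coeff N D c i * X c) = bound N D i)"

lemma finite_cube_columns: "finite (cube_columns N D)"
  by (simp add: cube_columns_def)

lemma vertex_columns_subset: "vertex_columns N D C \<tau> \<subseteq> cube_columns N D"
  by (auto simp: vertex_columns_def cube_columns_def)

lemma sum_cube_columns:
  fixes f :: "column \<Rightarrow> rat"
  shows "(\<Sum>c\<in>cube_columns N D. f c)
    = f (Chain 0) + f (Chain 1) + (\<Sum>k=2..N+1. f (Chain k)) + (\<Sum>j<D. f (Lo j)) + (\<Sum>j<D. f (Up j)) + f Cap"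
proof -
  have "(\<Sum>c\<in>cube_columns N D. f c)
    = (\<Sum>c\<in>Chain ` {..N + 1}. f c) + (\<Sum>c\<in>Lo ` {..<D}. f c) + (\<Sum>c\<in>Up ` {..<D}. f c) + f Cap"
    unfolding cube_columns_def
    by (subst sum.union_disjoint, auto)+
  also have "\<dots> = (\<Sum>k\<le>N + 1. f (Chain k)) + (\<Sum>j<D. f (Lo j)) + (\<Sum>j<D. f (Up j)) + f Cap"
    by (simp add: sum.reindex inj_on_def)
  also have "{..N + 1} = insert 0 (insert 1 {2..N + 1})" by auto
  finally show ?thesis by simp
qed

lemma cube_solution_nonneg: "cube_solution N D X \<Longrightarrow> X c \<ge> 0"
  by (simp add: cube_solution_def)

lemma cube_solution_row:
  assumes "cube_solution N D X" "i < D + N + 1"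
  shows "coeff N D (Chain 0) i * X (Chain 0) + coeff N D (Chain 1) i * X (Chain 1)
     + (\<Sum>k=2..N+1. coeff N D (Chain k) i * X (Chain k)) + (\<Sum>j<D. coeff N D (Lo j) i * X (Lo j))
     + (\<Sum>j<D. coeff N D (Up j) i * X (Up j)) + coeff N D Cap i * X Cap = bound N D i"
  using assms unfolding cube_solution_def sum_cube_columns by blast

lemma cube_solution_Cap:
  assumes "cube_solution N D X"
  shows "X Cap = 1"
proof -
  have "(\<Sum>k=2..N+1. coeff N D (Chain k) D * X (Chain k)) = 0"
    and "(\<Sum>j<D. coeff N D (Lo j) D * X (Lo j)) = 0" "(\<Sum>j<D. coeff N D (Up j) D * X (Up j)) = 0"
    by (auto intro!: sum.neutral)
  with cube_solution_row[OF assms, of D] show ?thesis by (simp add: bound_def)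
qed

lemma cube_solution_bit:
  assumes "cube_solution N D X" "i < D"
  shows "X (Lo i) + X (Up i) + 2 * (\<Sum>j<i. X (Lo j)) + 2 * X (Chain 0) = 2 * of_nat N * 3 ^ Suc i"
proof -
  have "(\<Sum>k=2..N+1. coeff N D (Chain k) i * X (Chain k)) = 0"
    using assms by (auto intro!: sum.neutral)
  moreover have "(\<Sum>j<D. coeff N D (Up j) i * X (Up j)) = (\<Sum>j<D. if j = i then X (Up i) else 0)"
    by (intro sum.cong) auto
  moreover have "(\<Sum>j<D. coeff N D (Lo j) i * X (Lo j))
      = (\<Sum>j<D. (if j = i then X (Lo i) else 0) + (if j < i then 2 * X (Lo j) else 0))"
    using assms by (intro sum.cong) auto
  moreover have "(\<Sum>j<D. if j < i then 2 * X (Lo j) else 0) = (\<Sum>j<i. 2 * X (Lo j))"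
    using assms by (intro sum.mono_neutral_cong_right) auto
  ultimately show ?thesis
    using cube_solution_row[OF assms(1), of i] assms
    by (simp add: bound_def sum.distrib sum_distrib_left)
qed

lemma cube_solution_chain:
  assumes "cube_solution N D X" "1 \<le> k" "k \<le> N"
  shows "X (Chain k) = X (Chain 1) - of_nat (k - 1) * X (Chain 0) + of_nat (k - 1) * of_nat k"
proof (cases "k = 1")
  case False
  define i where "i = D + k - 1"
  have i: "D < i" "i < D + N" "i - D = k - 1" "Suc i = D + k" using assms False by (auto simp: i_def)
  have "(\<Sum>l=2..N+1. coeff N D (Chain l) i * X (Chain l)) = (\<Sum>l=2..N+1. if l = k then X (Chain k) else 0)"
    using i by (intro sum.cong) auto
  moreover have "(\<Sum>j<D. coeff N D (Lo j) i * X (Lo j)) = 0" "(\<Sum>j<D. coeff N D (Up j) i * X (Up j)) = 0"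
    using i by (auto intro!: sum.neutral)
  ultimately show ?thesis
    using cube_solution_row[OF assms(1), of i] assms i False
    by (simp add: bound_def of_nat_diff algebra_simps)
qed simp

lemma cube_solution_top:
  assumes "cube_solution N D X" "2 \<le> N"
  shows "X (Chain 0) + X (Chain (Suc N)) = 2 * of_nat N"
proof -
  have "(\<Sum>l=2..N+1. coeff N D (Chain l) (D + N) * X (Chain l))
      = (\<Sum>l=2..N+1. if l = Suc N then X (Chain (Suc N)) else 0)"
    by (intro sum.cong) auto
  moreover have "(\<Sum>j<D. coeff N D (Lo j) (D + N) * X (Lo j)) = 0"
    "(\<Sum>j<D. coeff N D (Up j) (D + N) * X (Up j)) = 0"
    by (auto intro!: sum.neutral)
  ultimately show ?thesis
    using cube_solution_row[OF assms(1), of "D + N"] assms by (simp add: bound_def)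
qed

text \<open>Everything below coordinate \<open>i\<close> totals at most \<open>2 * N * 3 ^ i\<close>
  and enters row \<open>i\<close> with factor 2, while the right-hand side is three times that
  total; so \<open>2 * N * 3 ^ i\<close> is left over. Opposite facets of a coordinate are thus
  disjoint.\<close>

lemma cube_solution_bit_pos:
  assumes "cube_solution N D X" "2 \<le> N" "i < D"
  shows "X (Lo i) + X (Up i) > 0"
proof -
  have "(\<Sum>j<i. X (Lo j)) + X (Chain 0) \<le> 2 * of_nat N * 3 ^ i"
    using \<open>i < D\<close>
  proof (induction i)
    case 0
    then show ?case
      using cube_solution_top[OF assms(1,2)] cube_solution_nonneg[OF assms(1), of "Chain (Suc N)"] by simp
  next
    case (Suc i)
    have "0 \<le> (\<Sum>j<i. X (Lo j))" by (intro sum_nonneg cube_solution_nonneg[OF assms(1)])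
    with Suc cube_solution_bit[OF assms(1), of i] cube_solution_nonneg[OF assms(1), of "Chain 0"]
      cube_solution_nonneg[OF assms(1), of "Up i"]
    show ?case by simp
  qed
  moreover have "2 * of_nat N * 3 ^ i > (0 :: rat)" using assms by simp
  ultimately show ?thesis using cube_solution_bit[OF assms(1,3)] by simp
qed

text \<open>Subtracting two secant equations eliminates \<open>Chain 1\<close>; the factored form
  shows the signs.\<close>

lemma cube_solution_edge:
  assumes "cube_solution N D X" "X (Chain e) = 0" "1 \<le> e" "e \<le> N" "1 \<le> k" "k \<le> N"
  shows "X (Chain k) = (of_nat k - of_nat e) * (of_nat k + of_nat e - 1 - X (Chain 0))"
  using cube_solution_chain[OF assms(1,3,4)] cube_solution_chain[OF assms(1,5,6)] assms
  by (simp add: of_nat_diff algebra_simps)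

text \<open>The slacks of the two neighbouring edges are nonnegative, which confines
  \<open>a = Chain 0 / 2\<close> to the interval from \<open>e - 1\<close> to \<open>e\<close>. At
  the extreme edges these slacks are \<open>Chain 0\<close> and
  \<open>Chain (Suc N)\<close>.\<close>

lemma cube_solution_edge_range:
  assumes "cube_solution N D X" "2 \<le> N" "X (Chain e) = 0" "1 \<le> e" "e \<le> N"
  shows "2 * of_nat e - 2 \<le> X (Chain 0)" "X (Chain 0) \<le> 2 * of_nat e"
proof -
  show "2 * of_nat e - 2 \<le> X (Chain 0)"
  proof (cases "e = 1")
    case True
    then show ?thesis using cube_solution_nonneg[OF assms(1)] by simp
  next
    case False
    with cube_solution_edge[OF assms(1,3,4,5), of "e - 1"] assms
      cube_solution_nonneg[OF assms(1), of "Chain (e - 1)"]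
    show ?thesis by (simp add: of_nat_diff)
  qed
  show "X (Chain 0) \<le> 2 * of_nat e"
  proof (cases "e = N")
    case True
    then show ?thesis
      using cube_solution_top[OF assms(1,2)] cube_solution_nonneg[OF assms(1), of "Chain (Suc N)"] by simp
  next
    case False
    with cube_solution_edge[OF assms(1,3,4,5), of "Suc e"] assms
      cube_solution_nonneg[OF assms(1), of "Chain (Suc e)"]
    show ?thesis by simp
  qed
qed

text \<open>A point of edge \<open>e\<close> can meet only the two neighbouring edges. During a lap
  this leaves a single candidate for the leaving column.\<close>

lemma cube_solution_edge_pos:
  assumes "cube_solution N D X" "2 \<le> N" "X (Chain e) = 0" "1 \<le> e" "e \<le> N"
    and "k \<le> N + 1" "Suc k \<noteq> e" "k \<noteq> e" "k \<noteq> Suc e"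
  shows "X (Chain k) > 0"
proof -
  note r = cube_solution_edge_range[OF assms(1-5)]
  consider "k = 0" | "k = Suc N" | "1 \<le> k" "Suc k < e" | "k \<le> N" "Suc e < k"
    using assms by linarith
  then show ?thesis
  proof cases
    case 1
    with assms have "2 \<le> e" by auto
    hence "(2::rat) \<le> of_nat e" by simp
    then show ?thesis using r unfolding 1 by linarith
  next
    case 2
    with assms have "Suc e \<le> N" by auto
    hence "(of_nat (Suc e) :: rat) \<le> of_nat N" by (subst of_nat_le_iff)
    then show ?thesis using r 2 cube_solution_top[OF assms(1,2)] by simp
  next
    case 3
    hence "(of_nat (k + 2) :: rat) \<le> of_nat e" by (subst of_nat_le_iff) simp
    then show ?thesis
      unfolding cube_solution_edge[OF assms(1,3-5) 3(1), OF less_imp_le_nat[OF less_le_trans[OF _ assms(5)], OF Suc_lessD[OF 3(2)]]]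
      using r by (intro mult_neg_neg) auto
  next
    case 4
    hence "(of_nat (e + 2) :: rat) \<le> of_nat k" by (subst of_nat_le_iff) simp
    moreover have "1 \<le> k" using 4 by simp
    ultimately show ?thesis
      unfolding cube_solution_edge[OF assms(1,3-5) \<open>1 \<le> k\<close> 4(1)]
      using r by (intro mult_pos_pos) auto
  qed
qed

text \<open>Here the polygon point is a fixed vertex, so the neighbouring slack left open by
  \<open>cube_solution_edge_pos\<close> can be evaluated exactly.\<close>

lemma cube_solution_lap_end_pos:
  assumes "cube_solution N D X" "2 \<le> N" "\<tau> = 0 \<or> \<tau> = N"
    and "X (Chain \<tau>) = 0" "X (Chain (Suc \<tau>)) = 0"
    and "k \<le> N + 1" "k \<noteq> \<tau>" "k \<noteq> Suc \<tau>"
  shows "X (Chain k) > 0"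
proof (cases "\<tau> = 0")
  case True
  show ?thesis
  proof (cases "k = 2")
    case True
    with \<open>\<tau> = 0\<close> cube_solution_edge[OF assms(1), of 1 2] assms show ?thesis by simp
  qed (use True cube_solution_edge_pos[OF assms(1,2), of 1 k] assms in auto)
next
  case False
  hence \<tau>: "\<tau> = N" using assms by simp
  show ?thesis
  proof (cases "Suc k = N")
    case True
    with \<tau> cube_solution_edge[OF assms(1), of N k] cube_solution_top[OF assms(1,2)] assms
    show ?thesis by (auto simp: algebra_simps)
  qed (use \<tau> cube_solution_edge_pos[OF assms(1,2), of N k] assms in auto)
qed

section \<open>Forced pivots along the path\<close>

definition at_vertex :: "nat \<Rightarrow> nat \<Rightarrow> column list \<Rightarrow> nat \<Rightarrow> nat \<Rightarrow> nat set \<Rightarrow> bool" where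
  "at_vertex N D cs C \<tau> B \<longleftrightarrow> B \<subseteq> {..<length cs} \<and> inj_on ((!) cs) B
     \<and> (!) cs ` B = vertex_columns N D C \<tau>"

text \<open>\<open>dual\<close> prices every basic column exactly, so the result is the same
  whichever copies of the columns the basis uses.\<close>

lemma improving_at_vertex:
  assumes "is_basis (column_lp N D cs) B" "at_vertex N D cs C \<tau> B"
    and "\<tau> \<le> N" "2 \<le> N" "sign C D = 1"
  shows "improving (column_lp N D cs) B = {i \<in> {..<length cs}. rcost N D C \<tau> (cs ! i) > 0}"
proof -
  have 0: "rcost N D C \<tau> (cs ! j) = 0" if "j \<in> B" for j
    using rcost_vertex_columns[OF assms(3-5)] assms(2) that by (auto simp: at_vertex_def)
  have "reduced_cost (column_lp N D cs) B i = rcost N D C \<tau> (cs ! i)" for i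
    using 0 by (subst reduced_cost_eq_dual[OF assms(1), of "dual N D C \<tau>"]) (auto simp: rcost_def)
  then show ?thesis unfolding improving_def using 0 by fastforce
qed

text \<open>The leaving index is forced because every solution supported on the enlarged basis is
  positive at all other basic columns.\<close>

lemma leaving_solution:
  assumes v: "at_vertex N D cs C \<tau> B" and i: "i < length cs" "cs ! i \<in> cube_columns N D"
    "cs ! i \<notin> vertex_columns N D C \<tau>" and j: "j \<in> B"
    and feas: "feasible_basis (column_lp N D cs) (insert i B - {j})"
  obtains X where "cube_solution N D X"
    "\<And>c. X c \<noteq> 0 \<Longrightarrow> c \<in> insert (cs ! i) (vertex_columns N D C \<tau>) - {cs ! j}"
proof -
  let ?L = "column_lp N D cs" and ?B = "insert i B - {j}"
  define x where "x = basic_sol ?L ?B"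
  have basis: "is_basis ?L ?B" using feas by (simp add: feasible_basis_def)
  have x0: "\<forall>k. k \<notin> ?B \<longrightarrow> x k = 0" unfolding x_def by (rule basic_sol_props[OF basis])
  have xpos: "k < length cs \<Longrightarrow> 0 \<le> x k" for k
    using feas by (simp add: feasible_basis_def x_def)
  have sub: "?B \<subseteq> {..<length cs}" using v i by (auto simp: at_vertex_def)
  have inj: "inj_on ((!) cs) (insert i B)"
    using v i by (auto simp: at_vertex_def)
  have img: "(!) cs ` ?B = insert (cs ! i) (vertex_columns N D C \<tau>) - {cs ! j}"
  proof -
    have "(!) cs ` ?B = (!) cs ` insert i B - (!) cs ` {j}"
      using j by (intro inj_on_image_set_diff[OF inj]) auto
    then show ?thesis using v by (simp add: at_vertex_def)
  qed
  have injB: "inj_on ((!) cs) ?B" using inj by (rule inj_on_subset) auto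
  \<comment> \<open>The basic solution of the new basis, transported from positions to
    columns.\<close>
  define X where "X c = (if c \<in> (!) cs ` ?B then x (the_inv_into ?B ((!) cs) c) else 0)" for c
  have Xx: "X (cs ! k) = x k" if "k \<in> ?B" for k
    using that injB by (auto simp: X_def the_inv_into_f_f)
  have "cube_solution N D X"
    unfolding cube_solution_def
  proof (intro conjI allI impI)
    fix c show "0 \<le> X c"
    proof (cases "c \<in> (!) cs ` ?B")
      case True
      then obtain k where "k \<in> ?B" "c = cs ! k" by auto
      then show ?thesis using Xx xpos sub by auto
    qed (simp add: X_def)
  next
    fix r assume r: "r < D + N + 1"
    have "(\<Sum>c\<in>cube_columns N D. coeff N D c r * X c) = (\<Sum>c\<in>(!) cs ` ?B. coeff N D c r * X c)"
    proof (rule sum.mono_neutral_right[OF finite_cube_columns])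
      show "(!) cs ` ?B \<subseteq> cube_columns N D"
        unfolding img using i vertex_columns_subset[of N D C \<tau>] by auto
    qed (auto simp: X_def)
    also have "\<dots> = (\<Sum>k\<in>?B. coeff N D (cs ! k) r * X (cs ! k))"
      by (simp add: sum.reindex[OF injB])
    also have "\<dots> = (\<Sum>k\<in>?B. coeff N D (cs ! k) r * x k)"
      by (intro sum.cong refl) (simp add: Xx)
    also have "\<dots> = bound N D r"
      using basic_sol_props(1)[OF basis] r by (simp add: x_def)
    finally show "(\<Sum>c\<in>cube_columns N D. coeff N D c r * X c) = bound N D r" .
  qed
  moreover have "X c \<noteq> 0 \<Longrightarrow> c \<in> insert (cs ! i) (vertex_columns N D C \<tau>) - {cs ! j}" for c
    unfolding img[symmetric] by (auto simp: X_def split: if_splits)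
  ultimately show ?thesis using that by blast
qed

lemma at_vertex_exchange:
  assumes "at_vertex N D cs C \<tau> B" "i < length cs" "cs ! i \<notin> vertex_columns N D C \<tau>" "j \<in> B"
    and "vertex_columns N D C' \<tau>' = insert (cs ! i) (vertex_columns N D C \<tau>) - {cs ! j}"
  shows "at_vertex N D cs C' \<tau>' (insert i B - {j})"
proof -
  have inj: "inj_on ((!) cs) (insert i B)" using assms by (auto simp: at_vertex_def)
  have "(!) cs ` (insert i B - {j}) = (!) cs ` insert i B - (!) cs ` {j}"
    using assms by (intro inj_on_image_set_diff[OF inj]) auto
  moreover have "inj_on ((!) cs) (insert i B - {j})" by (rule inj_on_subset[OF inj]) auto
  ultimately show ?thesis using assms by (auto simp: at_vertex_def)
qed

text \<open>\<open>Cap\<close> has value 1, and in each coordinate one of \<open>Lo\<close> and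
  \<open>Up\<close> stays nonbasic at 0, so the other is positive. If no bit enters, only a chain
  column can leave.\<close>

lemma nonbasic_bit_leaving:
  assumes "cube_solution N D X" "2 \<le> N" "c \<in> vertex_columns N D C \<tau>" "X c = 0"
    and "\<And>c. X c \<noteq> 0 \<Longrightarrow> c \<in> insert t (vertex_columns N D C \<tau>)"
    and "\<And>k. t \<noteq> Lo k" "\<And>k. t \<noteq> Up k"
  shows "\<exists>k. c = Chain k"
proof -
  have "X (Up j) = 0" if "digit C j \<noteq> digit C (Suc j)" for j
    using assms(5)[of "Up j"] assms(7)[of j] that by (auto simp: vertex_columns_def)
  moreover have "X (Lo j) = 0" if "digit C j = digit C (Suc j)" for j
    using assms(5)[of "Lo j"] assms(6)[of j] that by (auto simp: vertex_columns_def)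
  moreover note cube_solution_bit_pos[OF assms(1,2)] cube_solution_Cap[OF assms(1)]
  ultimately show ?thesis using assms(3,4) unfolding vertex_columns_def by fastforce
qed

text \<open>\<open>Chain (Suc \<tau>)\<close> stays 0, so the solution lies on edge
  \<open>Suc \<tau>\<close>. Of its two neighbours \<open>Chain \<tau>\<close> enters, hence
  \<open>Chain (Suc (Suc \<tau>))\<close> leaves.\<close>

lemma lap_step_up:
  assumes v: "at_vertex N D cs C \<tau> B" and N: "2 \<le> N" "\<tau> < N"
    and i: "i < length cs" "cs ! i = Chain \<tau>" and j: "j \<in> B"
    and feas: "feasible_basis (column_lp N D cs) (insert i B - {j})"
  shows "at_vertex N D cs C (Suc \<tau>) (insert i B - {j})"
proof -
  have new: "cs ! i \<notin> vertex_columns N D C \<tau>" using i by (auto simp: vertex_columns_def)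
  have "cs ! i \<in> cube_columns N D" using i N by (auto simp: cube_columns_def)
  from leaving_solution[OF v i(1) this new j feas] obtain X where X: "cube_solution N D X"
    "\<And>c. X c \<noteq> 0 \<Longrightarrow> c \<in> insert (cs ! i) (vertex_columns N D C \<tau>) - {cs ! j}" by metis
  have cj: "cs ! j \<in> vertex_columns N D C \<tau>" using v j by (auto simp: at_vertex_def)
  have "X (cs ! j) = 0" using X(2) by blast
  have "\<exists>k. cs ! j = Chain k"
    by (rule nonbasic_bit_leaving[OF X(1) N(1) cj \<open>X (cs ! j) = 0\<close>, of "cs ! i"]) (use X(2) i in auto)
  then obtain k where k: "cs ! j = Chain k" by blast
  have "X (Chain (Suc \<tau>)) = 0" using X(2)[of "Chain (Suc \<tau>)"] i by (auto simp: vertex_columns_def)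
  from cube_solution_edge_pos[OF X(1) N(1) this, of k] k cj \<open>X (cs ! j) = 0\<close> N
  have "k = Suc (Suc \<tau>)" by (auto simp: vertex_columns_def)
  then show ?thesis using k i N
    by (intro at_vertex_exchange[OF v i(1) new j]) (auto simp: vertex_columns_def)
qed

text \<open>The same edge \<open>Suc \<tau>\<close>, traversed in the opposite direction.\<close>

lemma lap_step_down:
  assumes v: "at_vertex N D cs C (Suc \<tau>) B" and N: "2 \<le> N" "\<tau> < N"
    and i: "i < length cs" "cs ! i = Chain (Suc (Suc \<tau>))" and j: "j \<in> B"
    and feas: "feasible_basis (column_lp N D cs) (insert i B - {j})"
  shows "at_vertex N D cs C \<tau> (insert i B - {j})"
proof -
  have new: "cs ! i \<notin> vertex_columns N D C (Suc \<tau>)" using i by (auto simp: vertex_columns_def)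
  have "cs ! i \<in> cube_columns N D" using i N by (auto simp: cube_columns_def)
  from leaving_solution[OF v i(1) this new j feas] obtain X where X: "cube_solution N D X"
    "\<And>c. X c \<noteq> 0 \<Longrightarrow> c \<in> insert (cs ! i) (vertex_columns N D C (Suc \<tau>)) - {cs ! j}" by metis
  have cj: "cs ! j \<in> vertex_columns N D C (Suc \<tau>)" using v j by (auto simp: at_vertex_def)
  have "X (cs ! j) = 0" using X(2) by blast
  have "\<exists>k. cs ! j = Chain k"
    by (rule nonbasic_bit_leaving[OF X(1) N(1) cj \<open>X (cs ! j) = 0\<close>, of "cs ! i"]) (use X(2) i in auto)
  then obtain k where k: "cs ! j = Chain k" by blast
  have "X (Chain (Suc \<tau>)) = 0" using X(2)[of "Chain (Suc \<tau>)"] i by (auto simp: vertex_columns_def)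
  from cube_solution_edge_pos[OF X(1) N(1) this, of k] k cj \<open>X (cs ! j) = 0\<close> N
  have "k = \<tau>" by (auto simp: vertex_columns_def)
  then show ?thesis using k i N
    by (intro at_vertex_exchange[OF v i(1) new j]) (auto simp: vertex_columns_def)
qed

lemma digit_Suc: "digit C (Suc j) = digit (C div 2) j"
  by (simp add: digit_def div_mult2_eq)

lemma digit_decrement:
  assumes "digit C j" "\<And>i. i < j \<Longrightarrow> \<not> digit C i"
  shows "digit (C - 1) i = (if i \<le> j then \<not> digit C i else digit C i)"
  using assms
proof (induction j arbitrary: C i)
  case 0
  then obtain a where "C = 2 * a + 1" by (auto simp: digit_def elim: oddE)
  then show ?case by (cases i) (auto simp: digit_Suc, auto simp: digit_def)
next
  case (Suc j)
  have "\<not> digit C 0" using Suc.prems(2) by blast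
  then obtain a where a: "C = 2 * a" by (auto simp: digit_def elim: evenE)
  have "digit a j" "\<And>i. i < j \<Longrightarrow> \<not> digit a i"
    using Suc.prems(1) Suc.prems(2)[of "Suc _"] by (auto simp: a digit_Suc)
  note IH = Suc.IH[OF this]
  have "a \<noteq> 0" using \<open>digit a j\<close> by (cases "a = 0") (auto simp: digit_def)
  hence half: "(C - Suc 0) div 2 = a - Suc 0" and odd: "odd (C - 1)" by (auto simp: a)
  show ?case
  proof (cases i)
    case 0
    then show ?thesis using odd a by (simp add: digit_def)
  next
    case (Suc i')
    moreover have "digit C (Suc i') = digit a i'" by (simp add: digit_Suc a)
    ultimately show ?thesis using IH[of i'] by (simp add: digit_Suc[of "C - Suc 0"] half)
  qed
qed

text \<open>Of the two columns of coordinate \<open>j\<close>, the one that is nonbasic at counter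
  \<open>C\<close>.\<close>

definition bit_column :: "nat \<Rightarrow> nat \<Rightarrow> column" where
  "bit_column C j = (if digit C j = digit C (Suc j) then Lo j else Up j)"

text \<open>The polygon point rests at the end of its lap, where all basic chain columns are
  positive, and every coordinate other than \<open>b\<close> keeps its positive column. Only the
  partner of the entering column can leave.\<close>

lemma flip_step:
  assumes v: "at_vertex N D cs C \<tau> B" and N: "2 \<le> N" "\<tau> = 0 \<or> \<tau> = N"
    and b: "b < D" "digit C b" "\<And>i. i < b \<Longrightarrow> \<not> digit C i"
    and i: "i < length cs" "cs ! i = bit_column C b" and j: "j \<in> B"
    and feas: "feasible_basis (column_lp N D cs) (insert i B - {j})"
  shows "at_vertex N D cs (C - 1) \<tau> (insert i B - {j})"
proof -
  let ?V = "vertex_columns N D C \<tau>"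
  have new: "cs ! i \<notin> ?V" using i by (auto simp: vertex_columns_def bit_column_def)
  have "cs ! i \<in> cube_columns N D" using i b by (auto simp: cube_columns_def bit_column_def)
  from leaving_solution[OF v i(1) this new j feas] obtain X where X: "cube_solution N D X"
    "\<And>c. X c \<noteq> 0 \<Longrightarrow> c \<in> insert (cs ! i) ?V - {cs ! j}" by metis
  have cj: "cs ! j \<in> ?V" using v j by (auto simp: at_vertex_def)
  have Xj: "X (cs ! j) = 0" using X(2) by blast
  have "cs ! i \<noteq> Chain k" for k using i by (simp add: bit_column_def)
  hence "X (Chain k) = 0" if "Chain k \<notin> ?V" for k
    using X(2)[of "Chain k"] that by (metis DiffD1 insertE)
  hence "X (Chain \<tau>) = 0" "X (Chain (Suc \<tau>)) = 0" by (simp_all add: vertex_columns_def)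
  from cube_solution_lap_end_pos[OF X(1) N this] cj Xj
  have no_chain: "cs ! j \<noteq> Chain k" for k by (force simp: vertex_columns_def)
  have no_cap: "cs ! j \<noteq> Cap" using cube_solution_Cap[OF X(1)] Xj by force
  have "k = b" if "cs ! j = Lo k \<or> cs ! j = Up k" for k
  proof (rule ccontr)
    assume "k \<noteq> b"
    hence ne: "cs ! i \<noteq> Lo k" "cs ! i \<noteq> Up k" using i by (auto simp: bit_column_def)
    have "k < D" using cj that by (auto simp: vertex_columns_def)
    have "X c = 0" if "c \<notin> insert (cs ! i) ?V" for c
      using X(2)[of c] that by blast
    from this[of "Lo k"] this[of "Up k"] ne \<open>k < D\<close> cj Xj that
    have "X (Lo k) = 0 \<and> X (Up k) = 0" by (auto simp: vertex_columns_def)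
    with cube_solution_bit_pos[OF X(1) N(1) \<open>k < D\<close>] show False by simp
  qed
  hence "cs ! j = (if digit C b = digit C (Suc b) then Up b else Lo b)"
    using cj no_chain no_cap unfolding vertex_columns_def by auto
  \<comment> \<open>All digits up to \<open>b\<close> flip together, so equality of neighbouring
    digits changes only at \<open>b\<close>: a decrement is one step of the Gray code.\<close>
  moreover have "(digit (C - 1) k = digit (C - 1) (Suc k))
      = (if k = b then digit C k \<noteq> digit C (Suc k) else digit C k = digit C (Suc k))" for k
    using digit_decrement[OF b(2,3)] by (auto simp: Suc_le_eq)
  ultimately show ?thesis using i b
    by (intro at_vertex_exchange[OF v i(1) new j]) (auto simp: vertex_columns_def bit_column_def)
qed

section \<open>Initial basis and validity of the program\<close>

definition unit_column :: "nat \<Rightarrow> nat \<Rightarrow> column" where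
  "unit_column D i = (if i < D then Up i else if i = D then Cap else Chain (Suc i - D))"

lemma coeff_unit_column: "coeff N D (unit_column D i) k = of_bool (k = i)"
  by (auto simp: unit_column_def)

lemma inj_unit_column: "inj (unit_column D)"
proof (rule injI)
  fix i k assume "unit_column D i = unit_column D k"
  hence "coeff 0 D (unit_column D i) i = coeff 0 D (unit_column D k) i" by simp
  then show "i = k" by (simp add: coeff_unit_column of_bool_def split: if_splits)
qed

text \<open>With all digits set and \<open>\<tau> = 0\<close> every basic column is a unit vector.
  The basis matrix is an identity up to order, and the basic solution is the nonnegative right-hand
  side.\<close>

lemma vertex_columns_initial:
  assumes "\<And>j. j \<le> D \<Longrightarrow> digit C j"
  shows "vertex_columns N D C 0 = unit_column D ` {..<D + N + 1}"
proof (intro equalityI subsetI)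
  fix c assume "c \<in> vertex_columns N D C 0"
  then consider (chain) k where "c = Chain k" "2 \<le> k" "k \<le> N + 1" | (up) j where "c = Up j" "j < D"
    | (cap) "c = Cap"
    using assms by (fastforce simp: vertex_columns_def)
  then show "c \<in> unit_column D ` {..<D + N + 1}"
  proof cases
    case chain
    then show ?thesis by (intro image_eqI[of _ _ "D + k - 1"]) (auto simp: unit_column_def)
  next
    case up
    then show ?thesis by (intro image_eqI[of _ _ j]) (auto simp: unit_column_def)
  next
    case cap
    then show ?thesis by (intro image_eqI[of _ _ D]) (auto simp: unit_column_def)
  qed
next
  fix c assume "c \<in> unit_column D ` {..<D + N + 1}"
  then show "c \<in> vertex_columns N D C 0"
    using assms by (auto simp: unit_column_def vertex_columns_def)
qed

text \<open>Dual multipliers 1 on the cube rows and the top row cover the cube columns; secant rows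
  get 0 because \<open>Chain 1\<close> has negative entries there. Every dummy has entry 1 in row
  \<open>D\<close>, so a large multiplier \<open>M\<close> on that row covers all dummies.\<close>

lemma column_lp_bounded:
  assumes "0 < N" "\<And>j. Lo j \<in> set cs \<Longrightarrow> j < D"
    "\<And>j. Up j \<in> set cs \<Longrightarrow> j < D"
  shows "lp_bounded (column_lp N D cs)"
proof -
  define u :: "nat \<Rightarrow> rat" where "u i = (if i < D \<or> i = D + N then 1 else 0)" for i
  define w where "w c = cost c - (\<Sum>i<D + N + 1. (u(D := 0)) i * coeff N D c i)" for c
  define M where "M = (\<Sum>j<length cs. \<bar>w (cs ! j)\<bar>)"
  have M: "w (cs ! j) \<le> M" if "j < length cs" for j
  proof -
    have "\<bar>w (cs ! j)\<bar> \<le> M" unfolding M_def using that by (intro member_le_sum) auto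
    then show ?thesis by linarith
  qed
  have M0: "0 \<le> M" unfolding M_def by (intro sum_nonneg) auto
  have split: "(\<Sum>i<D + N + 1. (u(D := M)) i * coeff N D c i)
    = (\<Sum>i<D + N + 1. (u(D := 0)) i * coeff N D c i) + M * coeff N D c D" for c
    unfolding sum_rows_split by simp
  have nonneg: "0 \<le> (u(D := 0)) i" for i by (simp add: u_def)
  have "cost c \<le> (\<Sum>i<D + N + 1. (u(D := M)) i * coeff N D c i)" if c: "c \<in> set cs" for c
  proof -
    let ?s = "\<Sum>i<D + N + 1. (u(D := 0)) i * coeff N D c i"
    have at_least: "(u(D := 0)) i * coeff N D c i \<le> ?s"
      if "i < D + N + 1" "\<And>i. 0 \<le> (u(D := 0)) i * coeff N D c i" for i
      using that by (intro member_le_sum) auto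
    show ?thesis
    proof (cases c)
      case (Chain k)
      have pos: "0 \<le> (u(D := 0)) i * coeff N D c i" for i
        using Chain by (auto simp: u_def)
      show ?thesis
      proof (cases "k = 0")
        case True
        then show ?thesis
          using at_least[of "D + N"] pos Chain M0 split[of c] assms(1) by (simp add: u_def)
      next
        case False
        then show ?thesis using sum_nonneg[of "{..<D + N + 1}", OF pos] Chain split[of c]
          by (simp del: sum.lessThan_Suc)
      qed
    next
      case (Lo j)
      have pos: "0 \<le> (u(D := 0)) i * coeff N D c i" for i
        using Lo by (auto simp: u_def)
      show ?thesis using at_least[of j] pos Lo assms(2)[of j] c split[of c] by (simp add: u_def)
    next
      case (Up j)
      have pos: "0 \<le> (u(D := 0)) i * coeff N D c i" for i
        using Up by (auto simp: u_def)
      show ?thesis using at_least[of j] pos Up assms(3)[of j] c split[of c] by (simp add: u_def)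
    next
      case Cap
      have pos: "0 \<le> (u(D := 0)) i * coeff N D c i" for i
        using Cap by (auto simp: u_def)
      show ?thesis using at_least[of D] pos Cap split[of c] M0 by (simp add: u_def)
    next
      case (Dummy a g)
      obtain j where "j < length cs" "c = cs ! j" using c by (auto simp: in_set_conv_nth)
      with M[of j] Dummy split[of c] show ?thesis by (simp add: w_def)
    qed
  qed
  then show ?thesis by (intro lp_bounded_by_dual[of _ "u(D := M)"]) auto
qed

lemma column_lp_valid:
  assumes cs: "cube_columns N D \<subseteq> set cs" "\<And>j. Lo j \<in> set cs \<Longrightarrow> j < D" "\<And>j. Up j \<in> set cs \<Longrightarrow> j < D"
    and N: "2 \<le> N" and C: "\<And>j. j \<le> D \<Longrightarrow> digit C j"
  obtains B where "at_vertex N D cs C 0 B" "valid_lp (column_lp N D cs) B"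
proof -
  let ?L = "column_lp N D cs"
  note V = vertex_columns_initial[of D C N, OF C]
  have "vertex_columns N D C 0 \<subseteq> (!) cs ` {..<length cs}"
    using cs(1) vertex_columns_subset[of N D C 0] by (auto simp: set_conv_nth)
  then obtain B where B: "B \<subseteq> {..<length cs}" "inj_on ((!) cs) B" "vertex_columns N D C 0 = (!) cs ` B"
    unfolding subset_image_inj by blast
  hence at: "at_vertex N D cs C 0 B" by (simp add: at_vertex_def)
  have finB: "finite B" using B(1) by (rule finite_subset) simp
  have cardB: "card B = D + N + 1"
    using card_image[OF B(2)] card_image[OF inj_on_subset[OF inj_unit_column subset_UNIV], of D "{..<D + N + 1}"]
    by (simp add: B(3)[symmetric] V)
  have row: "(\<Sum>j\<in>B. coeff N D (cs ! j) i * x j) = x k" if "k \<in> B" "cs ! k = unit_column D i" for i k x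
  proof -
    have "coeff N D (cs ! j) i * x j = (if j = k then x k else 0)" if j: "j \<in> B" for j
    proof -
      obtain l where l: "cs ! j = unit_column D l" using j B(3) V by blast
      have "j = k \<longleftrightarrow> l = i"
        using l \<open>k \<in> B\<close> \<open>cs ! k = unit_column D i\<close> j inj_onD[OF B(2), of j k] injD[OF inj_unit_column, of D l i] by auto
      then show ?thesis using l by (auto simp: coeff_unit_column)
    qed
    hence "(\<Sum>j\<in>B. coeff N D (cs ! j) i * x j) = (\<Sum>j\<in>B. if j = k then x k else 0)"
      by (intro sum.cong) auto
    then show ?thesis using that finB by simp
  qed
  have unit: "\<exists>i<D + N + 1. cs ! k = unit_column D i" if "k \<in> B" for k
    using that B(3) V by auto
  have basis: "is_basis ?L B"
    unfolding is_basis_def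
  proof (intro conjI allI impI ballI)
    fix y k assume y: "\<forall>i<ncons ?L. (\<Sum>j\<in>B. mat ?L i j * y j) = 0" and k: "k \<in> B"
    obtain i where "i < D + N + 1" "cs ! k = unit_column D i" using unit[OF k] by blast
    then show "y k = 0" using row[OF k, of i y] y by simp
  qed (use B(1) cardB in auto)
  have "0 \<le> basic_sol ?L B k" for k
  proof (cases "k \<in> B")
    case True
    obtain i where "i < D + N + 1" "cs ! k = unit_column D i" using unit[OF True] by blast
    hence "basic_sol ?L B k = bound N D i"
      using row[OF True, of i "basic_sol ?L B"] basic_sol_props(1)[OF basis] by simp
    then show ?thesis by (simp add: bound_def)
  qed (use basic_sol_props(2)[OF basis] in auto)
  moreover have "full_row_rank ?L"
    unfolding full_row_rank_def
  proof (intro allI impI)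
    fix y i
    assume y: "\<forall>j<nvars ?L. (\<Sum>i<ncons ?L. y i * mat ?L i j) = 0" and i: "i < ncons ?L"
    have "unit_column D i \<in> (!) cs ` B" using i B(3) V by auto
    then obtain j where j: "j \<in> B" "cs ! j = unit_column D i" by auto
    have "(\<Sum>k<ncons ?L. y k * mat ?L k j) = (\<Sum>k<ncons ?L. if k = i then y i else 0)"
      by (intro sum.cong) (auto simp: j coeff_unit_column)
    also have "\<dots> = y i" using i by (subst sum.delta) auto
    finally have "(\<Sum>k<ncons ?L. y k * mat ?L k j) = y i" .
    moreover have "j < nvars ?L" using j(1) B(1) by auto
    ultimately show "y i = 0" using y by metis
  qed
  moreover have "ncons ?L \<le> nvars ?L"
    using card_mono[OF _ B(1)] cardB by simp
  moreover have "lp_bounded ?L" by (rule column_lp_bounded) (use cs N in auto)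
  ultimately have "valid_lp ?L B" using basis by (simp add: valid_lp_def feasible_basis_def)
  with at that show ?thesis by blast
qed

section \<open>Placing the desired column at the prescribed rank\<close>

text \<open>The order makes the desired pivot the first improving column: chain columns precede the
  bits, and bits are sorted by coordinate.\<close>

definition ladder :: "nat \<Rightarrow> nat \<Rightarrow> column list" where
  "ladder N D = map Chain [0..<N + 2] @ concat (map (\<lambda>j. [Lo j, Up j]) [0..<D])"

definition mid_lap :: "nat \<Rightarrow> nat \<Rightarrow> nat \<Rightarrow> bool" where
  "mid_lap N C \<tau> \<longleftrightarrow> (if odd C then \<tau> < N else 0 < \<tau>)"

definition moves :: "nat \<Rightarrow> nat \<Rightarrow> nat \<Rightarrow> nat \<Rightarrow> column list" where
  "moves N D C \<tau> = (if mid_lap N C \<tau> then [Chain (if odd C then \<tau> else Suc \<tau>)] else [])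
     @ map (bit_column C) (filter (digit C) [0..<D])"

abbreviation attractive :: "nat \<Rightarrow> nat \<Rightarrow> nat \<Rightarrow> nat \<Rightarrow> column \<Rightarrow> bool" where
  "attractive N D C \<tau> c \<equiv> rcost N D C \<tau> c > 0"

lemma set_ladder: "set (ladder N D) \<union> {Cap} = cube_columns N D"
  by (auto simp: ladder_def cube_columns_def)

lemma filter_eq_upt: "filter (\<lambda>k. k = a \<and> Q) [0..<b] = (if a < b \<and> Q then [a] else [])"
  by (induction b) auto

lemma concat_map_if: "concat (map (\<lambda>x. if Q x then [f x] else []) xs) = map f (filter Q xs)"
  by (induction xs) auto

lemma filter_ladder:
  assumes "\<tau> \<le> N" "2 \<le> N" "sign C D = 1"
  shows "filter (attractive N D C \<tau>) (ladder N D) = moves N D C \<tau>"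
proof -
  have "attractive N D C \<tau> (Chain k) \<longleftrightarrow> k = (if odd C then \<tau> else Suc \<tau>) \<and> mid_lap N C \<tau>"
    if "k < N + 2" for k
    using rcost_Chain[OF assms, of k] that by (auto simp: mid_lap_def sign_def digit_def)
  hence "filter (\<lambda>k. attractive N D C \<tau> (Chain k)) [0..<N + 2]
      = filter (\<lambda>k. k = (if odd C then \<tau> else Suc \<tau>) \<and> mid_lap N C \<tau>) [0..<N + 2]"
    by (intro filter_cong refl) (simp del: upt_Suc)
  also have "\<dots> = (if mid_lap N C \<tau> then [if odd C then \<tau> else Suc \<tau>] else [])"
    using assms unfolding filter_eq_upt by auto
  finally have 1: "filter (attractive N D C \<tau>) (map Chain [0..<N + 2])
      = (if mid_lap N C \<tau> then [Chain (if odd C then \<tau> else Suc \<tau>)] else [])"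
    by (simp add: filter_map o_def del: upt_Suc)
  have "map (\<lambda>j. filter (attractive N D C \<tau>) [Lo j, Up j]) [0..<D]
      = map (\<lambda>j. if digit C j then [bit_column C j] else []) [0..<D]"
    by (intro map_cong refl) (auto simp: rcost_Lo[OF assms(1) _ assms(3)] rcost_Up[OF assms(1)] bit_column_def sign_def)
  hence "filter (attractive N D C \<tau>) (concat (map (\<lambda>j. [Lo j, Up j]) [0..<D]))
      = map (bit_column C) (filter (digit C) [0..<D])"
    unfolding filter_concat map_map o_def by (simp only: concat_map_if)
  with 1 show ?thesis by (simp add: ladder_def moves_def del: upt_Suc)
qed

definition phase :: "nat \<Rightarrow> nat \<Rightarrow> nat" where
  "phase D C = (if odd C then if C = 2 ^ Suc D - 1 then 0 else 1 else 2)"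

text \<open>With \<open>A\<close> the sum of the \<open>D\<close> lower signs, \<open>A - D\<close>
  is 0 in the first lap and at most -2 later, so in phase 0 a term of absolute value 1 decides. In
  phase 1 the value on \<open>S\<close> is \<open>D - A - 1\<close> for odd counters, positive
  exactly after the first lap. In phase 2 the value is 1 on \<open>S\<close> for even counters. All
  other cases are negative.\<close>

definition filler :: "nat \<Rightarrow> nat \<Rightarrow> nat \<Rightarrow> nat set \<Rightarrow> column" where
  "filler N D \<phi> S =
     (if \<phi> = 0 then probe N D (- of_nat D) (\<lambda>_. 1) (\<lambda>\<tau>. if \<tau> \<in> S then 1 else -1)
      else if \<phi> = 1 then probe N D (- of_nat (D + 1))
        (\<lambda>j. -1 + (if j = 0 then 2 * of_nat D + 1 else 0)) (\<lambda>\<tau>. if \<tau> \<in> S then -1 else - 2 * of_nat D - 1)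
      else probe N D (-1) (\<lambda>j. if j = 0 then -1 else 0) (\<lambda>\<tau>. if \<tau> \<in> S then -1 else 1))"

lemma digits_all_set: "C < 2 ^ D \<Longrightarrow> (\<forall>j<D. digit C j) \<longleftrightarrow> C = 2 ^ D - 1"
proof (induction D arbitrary: C)
  case (Suc D)
  have "(\<forall>j<Suc D. digit C j) \<longleftrightarrow> odd C \<and> (\<forall>j<D. digit (C div 2) j)"
    unfolding All_less_Suc2 digit_Suc by (simp add: digit_def)
  also have "(\<forall>j<D. digit (C div 2) j) \<longleftrightarrow> C div 2 = 2 ^ D - 1"
    using Suc.prems by (intro Suc.IH) (simp add: less_mult_imp_div_less mult.commute)
  also have "odd C \<and> C div 2 = 2 ^ D - 1 \<longleftrightarrow> C = 2 ^ Suc D - 1"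
  proof -
    have "odd C \<and> C div 2 = p - 1 \<longleftrightarrow> C = 2 * p - 1" if "1 \<le> p" for p
      using that by presburger
    from this[of "2 ^ D"] show ?thesis by simp
  qed
  finally show ?case .
qed simp

lemma digits_all_clear: "(\<forall>j<D. \<not> digit C j) \<Longrightarrow> 2 ^ D dvd C"
proof (induction D arbitrary: C)
  case (Suc D)
  hence "2 ^ D dvd C div 2" by (auto simp: digit_Suc[symmetric])
  moreover have "even C" using Suc.prems by (auto simp: digit_def dest: spec[of _ 0])
  ultimately show ?case by (metis dvd_mult_div_cancel mult_dvd_mono dvd_refl power_Suc)
qed simp

lemma digit_top:
  assumes "2 ^ D \<le> C" "C < 2 ^ Suc D"
  shows "digit C D" "sign C D = 1"
proof -
  have "C div 2 ^ D = 1" using assms by (intro div_nat_eqI) auto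
  then show "digit C D" by (simp add: digit_def)
  then show "sign C D = 1" by (simp add: sign_def)
qed

lemma attractive_filler:
  assumes "\<tau> \<le> N" "1 \<le> D" "2 ^ D \<le> C" "C < 2 ^ Suc D" "\<phi> < 3"
  shows "attractive N D C \<tau> (filler N D \<phi> S) \<longleftrightarrow> phase D C = \<phi> \<and> \<tau> \<in> S"
proof -
  note rc = rcost_probe[OF assms(1) digit_top(2)[OF assms(3,4)]]
  define A where "A = (\<Sum>j<D. sign C j)"
  have "(\<Sum>j<D. (if j = 0 then c else 0) * sign C j) = (\<Sum>j<D. if j = 0 then c * sign C 0 else 0)" for c
    by (intro sum.cong) auto
  hence pick: "(\<Sum>j<D. (if j = 0 then c else 0) * sign C j) = c * sign C 0" for c
    using assms(2) by simp
  have s0: "sign C 0 = (if odd C then 1 else -1)" by (simp add: sign_def digit_def)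
  have "(\<Sum>j<D. -1) \<le> A" "A \<le> (\<Sum>j<D. 1)"
    unfolding A_def by (intro sum_mono; simp add: sign_def)+
  hence A: "- of_nat D \<le> A" "A \<le> of_nat D" by simp_all
  have all: "(\<forall>j<D. digit C j) \<longleftrightarrow> C = 2 ^ Suc D - 1"
    using digits_all_set[OF assms(4)] digit_top(1)[OF assms(3,4)] by (auto simp: less_Suc_eq)
  define F where "F \<longleftrightarrow> C = 2 ^ Suc D - 1"
  have ph: "phase D C = (if odd C then if F then 0 else 1 else 2)" by (simp add: phase_def F_def)
  have A_first: "A = of_nat D" if F
    using all that by (simp add: A_def sign_def F_def)
  \<comment> \<open>One clear digit lowers the sum of signs by 2; this gap separates the first lap
    from the later ones.\<close>
  have A_other: "A \<le> of_nat D - 2" if "\<not> F"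
  proof -
    have "\<exists>k<D. \<not> digit C k" using all that by (auto simp: F_def)
    then obtain k where k: "k < D" "\<not> digit C k" by blast
    have "A = sign C k + (\<Sum>j\<in>{..<D} - {k}. sign C j)"
      unfolding A_def using k by (intro sum.remove) auto
    moreover have "(\<Sum>j\<in>{..<D} - {k}. sign C j) \<le> (\<Sum>j\<in>{..<D} - {k}. 1)"
      by (intro sum_mono) (simp add: sign_def)
    moreover have "sign C k = -1" using k by (simp add: sign_def)
    ultimately show ?thesis using k by (simp add: of_nat_diff)
  qed
  have first_odd: "odd C" if F using that by (simp add: F_def)
  consider "\<phi> = 0" | "\<phi> = 1" | "\<phi> = 2" using assms(5) by linarith
  then show ?thesis
  proof cases
    case 1
    then have "rcost N D C \<tau> (filler N D \<phi> S) = A - of_nat D + sign C 0 * (if \<tau> \<in> S then 1 else -1)"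
      by (simp add: filler_def rc A_def)
    then show ?thesis using 1 A_first A_other first_odd
      by (cases F) (auto simp: s0 ph)
  next
    case 2
    have "(\<Sum>j<D. (-1 + (if j = 0 then 2 * of_nat D + 1 else 0)) * sign C j)
        = (2 * of_nat D + 1) * sign C 0 - A"
      unfolding distrib_right sum.distrib pick by (simp add: A_def sum_negf)
    with 2 have "rcost N D C \<tau> (filler N D \<phi> S)
        = (2 * of_nat D + 1) * sign C 0 - A - of_nat (D + 1)
          + sign C 0 * (if \<tau> \<in> S then -1 else - 2 * of_nat D - 1)"
      by (simp add: filler_def rc)
    then show ?thesis using 2 A_first A_other first_odd A
      by (cases F) (auto simp: s0 ph)
  next
    case 3
    then have "rcost N D C \<tau> (filler N D \<phi> S)
        = - 1 - sign C 0 + sign C 0 * (if \<tau> \<in> S then -1 else 1)"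
      by (simp add: filler_def rc pick)
    then show ?thesis using 3 by (auto simp: s0 ph)
  qed
qed

definition complements :: "nat \<Rightarrow> nat \<Rightarrow> column list" where
  "complements N D = map (\<lambda>j. probe N D 0 (\<lambda>i. if i = j then -1 else 0) (\<lambda>_. 0)) [0..<D]"

definition fillers :: "nat \<Rightarrow> nat \<Rightarrow> nat \<Rightarrow> (nat \<Rightarrow> nat \<Rightarrow> nat) \<Rightarrow> column list" where
  "fillers N D K count =
     concat (map (\<lambda>\<phi>. map (\<lambda>i. filler N D \<phi> {\<tau>. i < count \<phi> \<tau>}) [0..<K]) [0, 1, 2])"

lemma length_filter_less:
  "c \<le> K \<Longrightarrow> length (filter (\<lambda>i. Q \<and> i < c) [0..<K]) = (if Q then c else 0)"
proof (induction K)
  case (Suc K)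
  then show ?case
  proof (cases "c = Suc K")
    case True
    have "filter (\<lambda>i. Q \<and> i < Suc K) [0..<Suc K] = filter (\<lambda>i. Q) [0..<Suc K]"
      by (intro filter_cong) auto
    with True show ?thesis by simp
  qed simp
qed simp

text \<open>A complement improves when its digit is clear, which compensates for the improving bits
  of one ladder. The layout has two ladders and hence two copies.\<close>

lemma length_filter_complements:
  assumes "\<tau> \<le> N" "sign C D = 1"
  shows "length (filter (attractive N D C \<tau>) (complements N D)) + length (filter (digit C) [0..<D]) = D"
proof -
  have "rcost N D C \<tau> (probe N D 0 (\<lambda>i. if i = j then -1 else 0) (\<lambda>_. 0)) = - sign C j" if "j < D" for j
  proof -
    have "(\<Sum>i<D. (if i = j then -1 else 0) * sign C i) = (\<Sum>i<D. if i = j then - sign C j else 0)"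
      by (intro sum.cong) auto
    then show ?thesis using that by (simp add: rcost_probe[OF assms])
  qed
  hence "filter (\<lambda>j. attractive N D C \<tau> (probe N D 0 (\<lambda>i. if i = j then -1 else 0) (\<lambda>_. 0))) [0..<D]
      = filter (\<lambda>j. \<not> digit C j) [0..<D]"
    by (intro filter_cong refl) (simp add: sign_def)
  then show ?thesis
    using sum_length_filter_compl[of "digit C" "[0..<D]"]
    by (simp add: complements_def filter_map o_def)
qed

lemma length_filter_fillers:
  assumes "\<tau> \<le> N" "1 \<le> D" "2 ^ D \<le> C" "C < 2 ^ Suc D" "\<And>\<phi>. count \<phi> \<tau> \<le> K"
  shows "length (filter (attractive N D C \<tau>) (fillers N D K count)) = count (phase D C) \<tau>"
proof -
  have "length (filter (attractive N D C \<tau>) (map (\<lambda>i. filler N D \<phi> {\<tau>. i < count \<phi> \<tau>}) [0..<K]))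
      = (if phase D C = \<phi> then count \<phi> \<tau> else 0)" if "\<phi> < 3" for \<phi>
    using length_filter_less[OF assms(5)] that
    by (simp add: filter_map o_def attractive_filler[OF assms(1-4)])
  moreover have "phase D C \<in> {0, 1, 2}" by (simp add: phase_def)
  ultimately show ?thesis by (auto simp: fillers_def)
qed

section \<open>Numbers of fillers and the final column order\<close>

definition left_count :: "nat \<Rightarrow> (nat \<Rightarrow> nat \<Rightarrow> nat) \<Rightarrow> nat \<Rightarrow> nat \<Rightarrow> nat" where
  "left_count D pos \<phi> \<tau> = (if pos \<phi> \<tau> \<le> 2 * D + 4 then pos \<phi> \<tau> - 1 else 0)"

definition right_count :: "nat \<Rightarrow> (nat \<Rightarrow> nat \<Rightarrow> nat) \<Rightarrow> nat \<Rightarrow> nat \<Rightarrow> nat" where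
  "right_count D pos \<phi> \<tau> = (if pos \<phi> \<tau> \<le> 2 * D + 4 then 0 else 4 * D + 8 - pos \<phi> \<tau>)"

text \<open>The remainder up to \<open>4 * D + 8\<close>: bits and complements of both ladders
  contribute \<open>2 * D\<close>, and a lap move, if present, occurs twice; the condition is
  \<open>mid_lap\<close> expressed by the phase. For ranks from 1 to \<open>4 * D + 8\<close> the
  left and right counts total at most \<open>2 * D + 3\<close>, so no subtraction truncates.\<close>

definition mid_count :: "nat \<Rightarrow> nat \<Rightarrow> (nat \<Rightarrow> nat \<Rightarrow> nat) \<Rightarrow> nat \<Rightarrow> nat \<Rightarrow> nat" where
  "mid_count N D pos \<phi> \<tau> = 4 * D + 8 - left_count D pos \<phi> \<tau> - right_count D pos \<phi> \<tau>
     - 2 * D - 2 * of_bool (if \<phi> = 2 then 0 < \<tau> else \<tau> < N)"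

text \<open>At every vertex on the path exactly \<open>4 * D + 8\<close> columns are improving. The first ladder has the
  desired column as its first improving one, the reversed ladder as its last; the former serves
  small ranks, the latter large ones.\<close>

definition layout :: "nat \<Rightarrow> nat \<Rightarrow> (nat \<Rightarrow> nat \<Rightarrow> nat) \<Rightarrow> nat \<Rightarrow> column list" where
  "layout N D pos r =
     fillers N D (4 * D + 8) (left_count D pos) @ ladder N D
     @ fillers N D (4 * D + 8) (mid_count N D pos) @ complements N D @ complements N D
     @ rev (ladder N D) @ fillers N D (4 * D + 8) (right_count D pos)
     @ Cap # replicate r (probe N D (-1) (\<lambda>_. 0) (\<lambda>_. 0))"

lemma length_layout: "length (layout N D pos r) = 42 * D + 2 * N + 77 + r"
proof -
  have "length (ladder N D) = N + 2 + 2 * D"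
    by (simp add: ladder_def length_concat o_def sum_list_triv)
  moreover have "length (fillers N D K count) = 3 * K" for K count
    by (simp add: fillers_def)
  ultimately show ?thesis by (simp add: layout_def complements_def)
qed

lemma cube_columns_subset_layout: "cube_columns N D \<subseteq> set (layout N D pos r)"
  unfolding set_ladder[symmetric] by (auto simp: layout_def)

lemma filler_is_Dummy: "\<exists>c g. filler N D \<phi> S = Dummy c g"
  by (simp add: filler_def probe_def)

lemma set_layout_cases:
  assumes "c \<in> set (layout N D pos r)"
  shows "c \<in> cube_columns N D \<or> (\<exists>a g. c = Dummy a g)"
  using assms filler_is_Dummy unfolding set_ladder[symmetric]
  by (auto simp: layout_def fillers_def complements_def probe_def)

lemma filter_layout:
  assumes "\<tau> \<le> N" "2 \<le> N" "1 \<le> D" "2 ^ D \<le> C" "C < 2 ^ Suc D" "moves N D C \<tau> \<noteq> []"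
    and pos: "1 \<le> pos (phase D C) \<tau>" "pos (phase D C) \<tau> \<le> 4 * D + 8"
  shows "length (filter (attractive N D C \<tau>) (layout N D pos r)) = 4 * D + 8"
    and "filter (attractive N D C \<tau>) (layout N D pos r) ! (pos (phase D C) \<tau> - 1) = hd (moves N D C \<tau>)"
proof -
  let ?F = "filter (attractive N D C \<tau>)"
  let ?p = "pos (phase D C) \<tau>"
  note top = digit_top(2)[OF assms(4,5)]
  define fl where "fl = ?F (fillers N D (4 * D + 8) (left_count D pos))"
  define fm where "fm = ?F (fillers N D (4 * D + 8) (mid_count N D pos))"
  define fr where "fr = ?F (fillers N D (4 * D + 8) (right_count D pos))"
  define co where "co = ?F (complements N D)"
  define mv where "mv = moves N D C \<tau>"
  have "rcost N D C \<tau> (probe N D (-1) (\<lambda>_. 0) (\<lambda>_. 0)) = -1"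
    by (simp add: rcost_probe[OF assms(1) top])
  hence L: "?F (layout N D pos r) = fl @ mv @ fm @ co @ co @ rev mv @ fr"
    using filter_ladder[OF assms(1,2) top]
    by (simp add: layout_def fl_def fm_def fr_def co_def mv_def rev_filter[symmetric] rcost_Cap assms(1))
  have "left_count D pos \<phi> \<tau> \<le> 4 * D + 8" "mid_count N D pos \<phi> \<tau> \<le> 4 * D + 8"
    "right_count D pos \<phi> \<tau> \<le> 4 * D + 8" for \<phi>
    unfolding left_count_def mid_count_def right_count_def by auto
  hence len: "length fl = left_count D pos (phase D C) \<tau>"
    "length fm = mid_count N D pos (phase D C) \<tau>" "length fr = right_count D pos (phase D C) \<tau>"
    unfolding fl_def fm_def fr_def
    by (simp_all add: length_filter_fillers[OF assms(1,3-5)])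
  have lap: "mid_lap N C \<tau> \<longleftrightarrow> (if phase D C = 2 then 0 < \<tau> else \<tau> < N)"
    by (simp add: mid_lap_def phase_def)
  have lmv: "length mv + length co = of_bool (mid_lap N C \<tau>) + D"
    using length_filter_complements[OF assms(1) top] by (simp add: mv_def moves_def co_def)
  show K: "length (?F (layout N D pos r)) = 4 * D + 8"
  proof -
    define e :: nat where "e = of_bool (mid_lap N C \<tau>)"
    have "e \<le> 1" by (simp add: e_def)
    have "length fm = 4 * D + 8 - length fl - length fr - 2 * D - 2 * e"
      by (simp add: len mid_count_def e_def lap)
    moreover have "length fl + length fr \<le> 2 * D + 3"
      using pos by (simp add: len left_count_def right_count_def) linarith
    ultimately have "length fl + length fr + length fm + 2 * e + 2 * D = 4 * D + 8"
      using \<open>e \<le> 1\<close> by linarith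
    with lmv show ?thesis unfolding L e_def[symmetric] by simp
  qed
  have ne: "mv \<noteq> []" using assms(6) by (simp add: mv_def)
  show "?F (layout N D pos r) ! (?p - 1) = hd (moves N D C \<tau>)"
  \<comment> \<open>For a small rank exactly the left fillers precede the desired column; for a
    large one exactly the right fillers follow its copy in the reversed ladder.\<close>
  proof (cases "?p \<le> 2 * D + 4")
    case True
    hence "length fl = ?p - 1" by (simp add: len left_count_def)
    then show ?thesis using ne unfolding L mv_def[symmetric] by (simp add: nth_append hd_conv_nth)
  next
    case False
    hence "length fr = 4 * D + 8 - ?p" by (simp add: len right_count_def)
    with K pos have "?p = length (fl @ mv @ fm @ co @ co @ rev mv)" unfolding L by simp
    hence "?F (layout N D pos r) ! (?p - 1) = last (fl @ mv @ fm @ co @ co @ rev mv)"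
      using ne unfolding L by (subst last_conv_nth) (auto simp: nth_append)
    also have "\<dots> = hd mv" using ne by (simp add: last_rev)
    finally show ?thesis by (simp add: mv_def)
  qed
qed

text \<open>Transfers ranks from the sorted index set, on which the rule acts, to the filtered
  column list.\<close>

lemma sorted_list_of_selected:
  assumes "k < length (filter Q xs)"
  defines "S \<equiv> {i \<in> {..<length xs}. Q (xs ! i)}"
  shows "card S = length (filter Q xs)" "sorted_list_of_set S ! k < length xs"
    "xs ! (sorted_list_of_set S ! k) = filter Q xs ! k"
proof -
  let ?I = "filter (\<lambda>i. Q (xs ! i)) [0..<length xs]"
  have F: "filter Q xs = map ((!) xs) ?I"
    by (subst (1) map_nth[symmetric]) (simp add: filter_map o_def)
  have S: "S = set ?I" by (auto simp: S_def)
  have sl: "sorted_list_of_set S = ?I" unfolding S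
    by (intro sorted_list_of_set.idem_if_sorted_distinct) (auto intro: sorted_wrt_filter)
  have "card (set ?I) = length ?I" by (rule distinct_card) simp
  then show "card S = length (filter Q xs)" unfolding S F by (simp only: length_map)
  have k: "k < length ?I" using assms(1) unfolding F by simp
  show "sorted_list_of_set S ! k < length xs"
    using nth_mem[OF k] unfolding sl by simp
  show "xs ! (sorted_list_of_set S ! k) = filter Q xs ! k"
    unfolding sl F using k by simp
qed

section \<open>The run\<close>

text \<open>\<open>mem\<close> is the orbit of the memory under the constant count
  \<open>4 * D + 8\<close>. It is known before the program is built, so the columns may depend on it
  without circularity.\<close>

locale lap_schedule =
  fixes P :: "nat \<Rightarrow> nat \<Rightarrow> nat \<Rightarrow> nat \<times> nat" and N D n :: nat and mem :: "nat \<Rightarrow> nat"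
  assumes D_pos: "1 \<le> D" and N_ge: "2 \<le> N" and n_ge: "42 * D + 2 * N + 77 \<le> n"
    and rank_bounds: "fst (P (4 * D + 8) n (mem T)) \<in> {1..4 * D + 8}"
    and mem_0: "mem 0 = 1" and mem_Suc: "mem (Suc T) = snd (P (4 * D + 8) n (mem T))"
    and mem_periodic: "Suc N \<le> T \<Longrightarrow> mem (T + Suc N) = mem T"
begin

text \<open>Phase 0 is the first lap, which may contain the transient of the memory sequence; phases 1 and 2
  are the later upward and the downward laps, on which the memory sequence is periodic.\<close>

definition pos :: "nat \<Rightarrow> nat \<Rightarrow> nat" where
  "pos \<phi> \<tau> = fst (P (4 * D + 8) n (mem
     (if \<phi> = 0 then \<tau> else if \<phi> = 1 then Suc N + \<tau> else Suc N + (N - \<tau>))))"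

definition columns :: "column list" where
  "columns = layout N D pos (n - (42 * D + 2 * N + 77))"

definition program :: lp where
  "program = column_lp N D columns"

text \<open>A lap is \<open>N\<close> chain moves and one bit flip, hence \<open>Suc N\<close>
  steps; at the start all \<open>Suc D\<close> digits are set.\<close>

definition counter :: "nat \<Rightarrow> nat" where
  "counter T = 2 ^ Suc D - 1 - T div Suc N"

definition position :: "nat \<Rightarrow> nat" where
  "position T = (if odd (counter T) then T mod Suc N else N - T mod Suc N)"

definition on_track :: "nat \<Rightarrow> nat set \<times> nat \<Rightarrow> bool" where
  "on_track T s \<longleftrightarrow> is_basis program (fst s)
     \<and> at_vertex N D columns (counter T) (position T) (fst s) \<and> snd s = mem T"

lemma length_columns: "length columns = n"
  using n_ge by (simp add: columns_def length_layout)

lemma nvars_program: "nvars program = n"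
  by (simp add: program_def length_columns)

lemma initial_basis:
  obtains B where "valid_lp program B" "on_track 0 (B, 1)"
proof -
  have "digit (2 ^ Suc D - 1) j" if "j \<le> D" for j
    using digits_all_set[of "2 ^ Suc D - 1" "Suc D"] that by simp
  moreover have "j < D" if "Lo j \<in> set columns \<or> Up j \<in> set columns" for j
    using that set_layout_cases unfolding columns_def by (fastforce simp: cube_columns_def)
  ultimately obtain B where B: "at_vertex N D columns (2 ^ Suc D - 1) 0 B" "valid_lp program B"
    using column_lp_valid[of N D columns "2 ^ Suc D - 1"] cube_columns_subset_layout N_ge
    unfolding columns_def program_def by metis
  have "counter 0 = 2 ^ Suc D - 1" by (simp add: counter_def)
  moreover have "position 0 = 0" using \<open>counter 0 = _\<close> by (simp add: position_def)
  moreover have "is_basis program B" using B(2) by (simp add: valid_lp_def feasible_basis_def)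
  ultimately show ?thesis using B mem_0 by (intro that[of B]) (auto simp: on_track_def)
qed

lemma mem_lap: "1 \<le> q \<Longrightarrow> mem (q * Suc N + r) = mem (Suc N + r)"
proof (induction q)
  case (Suc q)
  show ?case
  proof (cases "q = 0")
    case False
    then obtain q' where "q = Suc q'" by (cases q) auto
    hence "Suc N \<le> q * Suc N + r" by simp
    hence "mem (q * Suc N + r + Suc N) = mem (q * Suc N + r)" by (rule mem_periodic)
    moreover have "q * Suc N + r + Suc N = Suc q * Suc N + r" by simp
    ultimately show ?thesis using Suc.IH False by (metis One_nat_def Suc_leI neq0_conv)
  qed simp
qed simp

lemma counter_bounds:
  assumes "T div Suc N < 2 ^ D"
  shows "2 ^ D \<le> counter T" "counter T < 2 ^ Suc D"
  using assms by (auto simp: counter_def)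

lemma position_le: "position T \<le> N"
proof -
  have "T mod Suc N < Suc N" by simp
  then show ?thesis by (simp add: position_def)
qed

text \<open>In the first lap \<open>pos\<close> reads \<open>mem T\<close> itself. Later,
  periodicity replaces the lap number by 1, and the offset in the lap is \<open>\<tau>\<close>
  upwards and \<open>N - \<tau>\<close> downwards.\<close>

lemma pos_on_track:
  assumes "T div Suc N < 2 ^ D"
  shows "pos (phase D (counter T)) (position T) = fst (P (4 * D + 8) n (mem T))"
proof -
  define q where "q = T div Suc N"
  define r where "r = T mod Suc N"
  have T: "T = q * Suc N + r" by (simp add: q_def r_def del: mult_Suc_right)
  have "r \<le> N" by (simp add: r_def less_Suc_eq_le[symmetric])
  have q: "q < 2 ^ D" using assms by (simp add: q_def)
  show ?thesis
  proof (cases "q = 0")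
    case True
    hence c: "counter T = 2 ^ Suc D - 1" by (simp add: counter_def q_def)
    hence "phase D (counter T) = 0" by (simp add: phase_def)
    moreover have "position T = T" using c T True \<open>r \<le> N\<close> by (simp add: position_def)
    ultimately show ?thesis by (simp add: pos_def)
  next
    case False
    hence m: "mem T = mem (Suc N + r)" using mem_lap[of q r] by (simp add: T del: mult_Suc_right)
    have "counter T \<noteq> 2 ^ Suc D - 1" using False q by (simp add: counter_def q_def)
    then show ?thesis
      using m \<open>r \<le> N\<close> by (auto simp: phase_def position_def pos_def r_def[symmetric])
  qed
qed

lemma on_track_improving:
  assumes s: "on_track T s" and q: "T div Suc N < 2 ^ D"
    and ne: "moves N D (counter T) (position T) \<noteq> []"
  defines "\<Gamma> \<equiv> improving program (fst s)"
  defines "i \<equiv> sorted_list_of_set \<Gamma> ! (fst (P (card \<Gamma>) n (snd s)) - 1)"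
  shows "card \<Gamma> = 4 * D + 8" "i < length columns"
    "columns ! i = hd (moves N D (counter T) (position T))"
proof -
  let ?C = "counter T" and ?\<tau> = "position T"
  note cb = counter_bounds[OF q]
  let ?Q = "attractive N D ?C ?\<tau>"
  have \<Gamma>: "\<Gamma> = {i \<in> {..<length columns}. ?Q (columns ! i)}"
    using s improving_at_vertex[OF _ _ position_le N_ge digit_top(2)[OF cb]]
    by (simp add: \<Gamma>_def on_track_def program_def)
  define p where "p = pos (phase D ?C) ?\<tau>"
  have p: "p = fst (P (4 * D + 8) n (snd s))" "1 \<le> p" "p \<le> 4 * D + 8"
    using pos_on_track[OF q] rank_bounds[of T] s by (simp_all add: p_def on_track_def)
  have L: "length (filter ?Q columns) = 4 * D + 8" "filter ?Q columns ! (p - 1) = hd (moves N D ?C ?\<tau>)"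
    using filter_layout[where pos = pos, OF position_le N_ge D_pos cb ne] p(2,3)
    by (simp_all add: columns_def p_def)
  have "p - 1 < length (filter ?Q columns)" using L(1) p by simp
  note S = sorted_list_of_selected[OF this, folded \<Gamma>]
  show card: "card \<Gamma> = 4 * D + 8" using S(1) L(1) by simp
  have "i = sorted_list_of_set \<Gamma> ! (p - 1)" by (simp add: i_def card p(1))
  then show "i < length columns" "columns ! i = hd (moves N D ?C ?\<tau>)" using S L(2) by simp_all
qed

text \<open>Inside a lap a chain move exists. At its end the next counter is still at least
  \<open>2 ^ D\<close>, so the present one lies strictly between \<open>2 ^ D\<close> and
  \<open>2 ^ Suc D\<close> and has a set digit below \<open>D\<close>.\<close>

lemma moves_nonempty:
  assumes "Suc T div Suc N < 2 ^ D"
  shows "moves N D (counter T) (position T) \<noteq> []"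
proof (cases "T mod Suc N = N")
  case True
  hence "Suc T div Suc N = Suc (T div Suc N)" by (simp add: div_Suc mod_Suc)
  hence "T div Suc N + 1 < 2 ^ D" using assms by simp
  hence c: "2 ^ D < counter T" "counter T < 2 * 2 ^ D" by (auto simp: counter_def)
  have "\<not> 2 ^ D dvd counter T"
  proof
    assume "2 ^ D dvd counter T"
    then obtain k where k: "counter T = 2 ^ D * k" by blast
    with c have "1 < k" "k < 2" by auto
    then show False by simp
  qed
  with digits_all_clear obtain j where "j < D" "digit (counter T) j" by blast
  hence "filter (digit (counter T)) [0..<D] \<noteq> []" by (auto simp: filter_empty_conv)
  then show ?thesis by (simp add: moves_def)
next
  case False
  moreover have "T mod Suc N < Suc N" by simp
  ultimately have "T mod Suc N < N" by linarith
  then show ?thesis by (auto simp: moves_def mid_lap_def position_def)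
qed

lemma hd_filter_upt:
  assumes "filter Q [0..<D] \<noteq> []"
  shows "hd (filter Q [0..<D]) < D" "Q (hd (filter Q [0..<D]))"
    "i < hd (filter Q [0..<D]) \<Longrightarrow> \<not> Q i"
  using assms
proof (induction D)
  case (Suc D)
  {
    case 1 then show ?case using Suc.IH(1) by (cases "filter Q [0..<D] = []") (auto split: if_splits)
  next
    case 2 then show ?case using Suc.IH(2) by (cases "filter Q [0..<D] = []") (auto split: if_splits)
  next
    case 3
    then show ?case using Suc.IH(3)
      by (cases "filter Q [0..<D] = []") (auto simp: filter_empty_conv split: if_splits)
  }
qed simp_all

lemma on_track_step:
  assumes s: "on_track T s" and step: "pivot_step program P s s'" and q': "Suc T div Suc N < 2 ^ D"
  shows "on_track (Suc T) s'"
proof -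
  let ?C = "counter T" and ?\<tau> = "position T"
  have q: "T div Suc N < 2 ^ D" using div_le_mono[of T "Suc T" "Suc N"] q' by linarith
  note cb = counter_bounds[OF q] and ne = moves_nonempty[OF q']
  define \<Gamma> where "\<Gamma> = improving program (fst s)"
  define i where "i = sorted_list_of_set \<Gamma> ! (fst (P (card \<Gamma>) n (snd s)) - 1)"
  note imp = on_track_improving[OF s q ne, folded \<Gamma>_def, folded i_def]
  obtain j where j: "j \<in> fst s" "fst s' = insert i (fst s) - {j}" "feasible_basis program (fst s')"
    and mem': "snd s' = snd (P (card \<Gamma>) n (snd s))"
    using step
    unfolding pivot_step_def Let_def case_prod_beta nvars_program \<Gamma>_def[symmetric] i_def[symmetric]
    by blast
  have v: "at_vertex N D columns ?C ?\<tau> (fst s)" using s by (simp add: on_track_def)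
  have feas: "feasible_basis (column_lp N D columns) (insert i (fst s) - {j})"
    using j by (simp add: program_def)
  have "snd s' = mem (Suc T)" using mem' s imp(1) by (simp add: mem_Suc on_track_def)
  moreover have "is_basis program (fst s')" using j(3) by (simp add: feasible_basis_def)
  moreover have "at_vertex N D columns (counter (Suc T)) (position (Suc T)) (fst s')"
  proof (cases "T mod Suc N = N")
    case False
    moreover have "T mod Suc N < Suc N" by simp
    ultimately have r: "T mod Suc N < N" by linarith
    hence r': "Suc T mod Suc N = Suc (T mod Suc N)" "Suc T div Suc N = T div Suc N"
      by (simp_all add: div_Suc mod_Suc)
    hence C': "counter (Suc T) = ?C" by (simp add: counter_def)
    show ?thesis
    proof (cases "odd ?C")
      case True
      hence "position (Suc T) = Suc ?\<tau>" "?\<tau> < N" using r r' C' by (simp_all add: position_def)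
      moreover have "columns ! i = Chain ?\<tau>"
        using imp(3) True \<open>?\<tau> < N\<close> by (simp add: moves_def mid_lap_def)
      ultimately show ?thesis
        using lap_step_up[OF v N_ge _ imp(2) _ j(1) feas] C' j(2) by simp
    next
      case False
      hence \<tau>: "?\<tau> = Suc (position (Suc T))" "position (Suc T) < N"
        using r r' C' by (auto simp: position_def)
      moreover have "columns ! i = Chain (Suc (Suc (position (Suc T))))"
        using imp(3) False \<tau> by (simp add: moves_def mid_lap_def)
      ultimately show ?thesis
        using lap_step_down[OF v[unfolded \<tau>(1)] N_ge \<tau>(2) imp(2) _ j(1) feas] C' j(2) by simp
    qed
  next
    case True
    hence r': "Suc T mod Suc N = 0" "Suc T div Suc N = Suc (T div Suc N)"
      by (simp_all add: div_Suc mod_Suc)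
    hence C': "counter (Suc T) = ?C - 1" by (simp add: counter_def)
    have \<tau>: "?\<tau> = (if odd ?C then N else 0)" using True by (simp add: position_def)
    \<comment> \<open>The flip changes the parity of the counter, so the next lap runs back from the
      end just reached and the position is unchanged.\<close>
    have "odd (counter (Suc T)) \<longleftrightarrow> even ?C" using C' cb by (cases "?C = 0") auto
    hence \<tau>': "position (Suc T) = ?\<tau>" using r' by (simp add: position_def[of "Suc T"] \<tau>)
    have "\<not> mid_lap N ?C ?\<tau>" by (simp add: mid_lap_def \<tau>)
    hence mv: "moves N D ?C ?\<tau> = map (bit_column ?C) (filter (digit ?C) [0..<D])"
      by (simp add: moves_def)
    with ne have nf: "filter (digit ?C) [0..<D] \<noteq> []" by simp
    have "columns ! i = bit_column ?C (hd (filter (digit ?C) [0..<D]))"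
      using imp(3) nf by (simp add: mv hd_map)
    from flip_step[OF v N_ge _ hd_filter_upt[OF nf] imp(2) this j(1) feas]
    show ?thesis using \<tau> C' \<tau>' j(2) by simp
  qed
  ultimately show ?thesis by (simp add: on_track_def)
qed

text \<open>A shorter run would end on track, where \<open>4 * D + 8\<close> columns improve. As a
  lap has \<open>Suc N\<close> steps, the first \<open>2 ^ D\<close> steps stay within the tracked
  part.\<close>

lemma run_length:
  assumes "on_track 0 (B, 1)" "simplex_run program P B ss t"
  shows "2 ^ D \<le> t"
proof (rule ccontr)
  assume "\<not> 2 ^ D \<le> t"
  hence t: "Suc t \<le> 2 ^ D" by simp
  have small: "Suc T div Suc N < 2 ^ D" if "T \<le> t" for T
  proof -
    have "Suc T \<le> 2 ^ D" using that t by simp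
    moreover have "(2::nat) ^ D < 2 ^ D * Suc N" using N_ge by simp
    ultimately have "Suc T < 2 ^ D * Suc N" by linarith
    then show ?thesis by (simp add: less_mult_imp_div_less del: mult_Suc_right)
  qed
  have "on_track T (ss T)" if "T \<le> t" for T
    using that
  proof (induction T)
    case 0
    then show ?case using assms by (simp add: simplex_run_def)
  next
    case (Suc T)
    then show ?case using on_track_step[of T "ss T"] small[of T] assms(2) by (simp add: simplex_run_def)
  qed
  hence track: "on_track t (ss t)" by simp
  have "t div Suc N < 2 ^ D" using div_le_mono[of t "Suc t" "Suc N"] small[of t] by linarith
  from on_track_improving(1)[OF track this moves_nonempty[OF small[OF order_refl]]] assms(2)
  show False by (simp add: simplex_run_def)
qed

end

section \<open>Periodic memory and the superpolynomial bound\<close>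

lemma eventually_periodic_orbit:
  fixes f :: "nat \<Rightarrow> nat"
  assumes "1 \<le> l" "\<And>T. x T \<in> {1..l}" "\<And>T. x (Suc T) = f (x T)"
  obtains M where "3 \<le> M" "M \<le> 4 * l" "\<And>T. M \<le> T \<Longrightarrow> x (T + M) = x T"
proof -
  have "\<not> inj_on x {..l}"
  proof
    assume "inj_on x {..l}"
    hence "card {..l} \<le> card {1..l}" using assms(2) by (intro card_inj_on_le) auto
    then show False by simp
  qed
  then obtain a b where ab: "a < b" "b \<le> l" "x a = x b"
    unfolding inj_on_def by (metis atMost_iff linorder_neqE_nat)
  define p where "p = b - a"
  have p: "1 \<le> p" "p \<le> l" "x (a + p) = x a" using ab by (auto simp: p_def)
  have period1: "x (a + i + p) = x (a + i)" for i
  proof (induction i)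
    case (Suc i)
    have "x (a + Suc i + p) = f (x (a + i + p))" by (simp add: assms(3)[symmetric])
    also have "\<dots> = x (a + Suc i)" by (simp add: Suc assms(3)[symmetric])
    finally show ?case .
  qed (use p in simp)
  have period: "x (a + i + p * c) = x (a + i)" for i c
  proof (induction c)
    case (Suc c)
    then show ?case using period1[of "i + p * c"] by (simp add: ac_simps)
  qed simp
  have l: "l = p * (l div p) + l mod p" "l mod p < p" using p by simp_all
  \<comment> \<open>\<open>p * (l div p)\<close> exceeds \<open>l - p\<close>, so with three more
    periods the multiple passes the preperiod \<open>a\<close> and is at least 3, as
    \<open>2 \<le> N\<close> requires; \<open>p \<le> l\<close> keeps it below or at
    \<open>4 * l\<close>.\<close>
  define c where "c = l div p + 3"
  have M: "p * c = p * (l div p) + 3 * p" by (simp add: c_def algebra_simps)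
  show ?thesis
  proof (rule that[of "p * c"])
    show "3 \<le> p * c" "p * c \<le> 4 * l" using M l p by linarith+
    fix T assume "p * c \<le> T"
    hence "a \<le> T" using M l p ab by linarith
    then show "x (T + p * c) = x T" using period[of "T - a" c] by simp
  qed
qed

lemma exponential_lp:
  assumes P: "index_selector ell P" and n: "1000 \<le> n" "100 * ell n \<le> n"
  obtains L B where "nvars L = n" "valid_lp L B"
    "\<And>ss t. simplex_run L P B ss t \<Longrightarrow> 2 ^ (n div 100) \<le> t"
proof -
  \<comment> \<open>The size \<open>42 * D + 2 * N + 77\<close> is then at most
    \<open>n / 2 + 77\<close>, since \<open>2 * N\<close> is at most
    \<open>8 * ell n\<close>.\<close>
  define D where "D = n div 100"
  define mem where "mem = rec_nat 1 (\<lambda>_ h. snd (P (4 * D + 8) n h))"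
  have mem: "mem 0 = 1" "mem (Suc T) = snd (P (4 * D + 8) n (mem T))" for T
    by (simp_all add: mem_def)
  have sel: "fst (P (4 * D + 8) n h) \<in> {1..4 * D + 8}" "snd (P (4 * D + 8) n h) \<in> {1..ell n}" for h
    using P unfolding index_selector_def by simp_all
  have "1 \<le> ell n" using sel(2)[of 0] by simp
  moreover have "mem T \<in> {1..ell n}" for T
    using \<open>1 \<le> ell n\<close> sel(2) by (cases T) (simp_all add: mem)
  ultimately obtain M where M: "3 \<le> M" "M \<le> 4 * ell n" "\<And>T. M \<le> T \<Longrightarrow> mem (T + M) = mem T"
    using eventually_periodic_orbit[of "ell n" mem "\<lambda>h. snd (P (4 * D + 8) n h)"] mem(2) by metis
  have D: "100 * D \<le> n" "n < 100 * D + 100" unfolding D_def by simp_all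
  interpret lap_schedule P "M - 1" D n mem
  proof
    show "1 \<le> D" "2 \<le> M - 1" "42 * D + 2 * (M - 1) + 77 \<le> n" using D M n by linarith+
  qed (use M mem sel in auto)
  obtain B where B: "valid_lp program B" "on_track 0 (B, 1)" by (rule initial_basis)
  have "2 ^ (n div 100) \<le> t" if "simplex_run program P B ss t" for ss t
    unfolding D_def[symmetric] by (rule run_length[OF B(2) that])
  with nvars_program B(1) show ?thesis by (rule that)
qed

text \<open>With \<open>a = n div b\<close>, the bound \<open>b ^ k \<le> a\<close> absorbs the
  constant factor, giving \<open>(a + 1) ^ Suc k\<close> and then \<open>2 ^ (a * Suc k)\<close>.
  The choice of \<open>b\<close> makes \<open>a * Suc k\<close> at most
  \<open>n div c\<close>.\<close>

lemma power_le_two_power_div: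
  fixes c k n :: nat
  defines "b \<equiv> c * Suc k"
  assumes "0 < c" "b * b ^ k \<le> n"
  shows "n ^ k \<le> 2 ^ (n div c)"
proof -
  have b: "0 < b" using assms by simp
  define a where "a = n div b"
  have "b ^ k \<le> a" using div_le_mono[OF assms(3), of b] b by (simp add: a_def)
  have "n < b * (a + 1)" using dividend_less_times_div[OF b, of n] by (simp add: a_def)
  hence "n ^ k \<le> (b * (a + 1)) ^ k" by (intro power_mono) auto
  also have "\<dots> \<le> (a + 1) * (a + 1) ^ k"
    unfolding power_mult_distrib using \<open>b ^ k \<le> a\<close> by (intro mult_right_mono) auto
  also have "\<dots> = (a + 1) ^ Suc k" by simp
  also have "\<dots> \<le> (2 ^ a) ^ Suc k"
    using less_exp[of a] by (intro power_mono) (simp_all add: Suc_le_eq)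
  also have "\<dots> = 2 ^ (a * Suc k)" by (simp only: power_mult)
  also have "\<dots> \<le> 2 ^ (n div c)"
  proof (intro power_increasing)
    have "a = n div c div Suc k" by (simp only: a_def b_def div_mult2_eq)
    then show "a * Suc k \<le> n div c" using div_times_less_eq_dividend by blast
  qed simp
  finally show ?thesis .
qed

text \<open>A placeholder for those \<open>n\<close> at which the construction does not fit.\<close>

definition zero_lp :: "nat \<Rightarrow> lp" where
  "zero_lp n = \<lparr>nvars = n, ncons = 0, mat = \<lambda>_ _. 0, rhs = \<lambda>_. 0, obj = \<lambda>_. 0\<rparr>"

lemma valid_zero_lp: "valid_lp (zero_lp n) {}"
proof -
  have "is_basis (zero_lp n) {}" by (simp add: is_basis_def zero_lp_def)
  moreover from basic_sol_props(2)[OF this] have "basic_sol (zero_lp n) {} j = 0" for j by simp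
  ultimately show ?thesis
    by (auto simp: valid_lp_def full_row_rank_def feasible_basis_def lp_bounded_def zero_lp_def)
qed

theorem theorem13:
  fixes ell :: "nat \<Rightarrow> nat" and P :: "nat \<Rightarrow> nat \<Rightarrow> nat \<Rightarrow> nat \<times> nat"
  assumes "(\<lambda>n. real (ell n)) \<in> o(\<lambda>n. real n / ln (real n))"
    and "index_selector ell P"
  shows "\<exists>LPs :: nat \<Rightarrow> lp \<times> nat set.
           (\<forall>n. nvars (fst (LPs n)) = n \<and> valid_lp (fst (LPs n)) (snd (LPs n))) \<and>
           (\<forall>k::nat. \<exists>N. \<forall>n\<ge>N. \<forall>ss t.
              simplex_run (fst (LPs n)) P (snd (LPs n)) ss t \<longrightarrow> t \<ge> n ^ k)"
proof -
  define small where "small n \<longleftrightarrow> 1000 \<le> n \<and> 100 * ell n \<le> n" for n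
  \<comment> \<open>Together with \<open>1 \<le> ln n\<close>, the constant \<open>1 / 100\<close>
    gives \<open>100 * ell n \<le> n\<close> eventually, as \<open>exponential_lp\<close>
    asks.\<close>
  have "\<forall>\<^sub>F n in sequentially. norm (real (ell n)) \<le> 1 / 100 * norm (real n / ln (real n))"
    using assms(1) by (rule landau_o.smallD) simp
  then obtain N0 where N0: "\<And>n. N0 \<le> n \<Longrightarrow> real (ell n) \<le> 1 / 100 * \<bar>real n / ln (real n)\<bar>"
    unfolding eventually_sequentially by auto
  have small: "small n" if n: "max 1000 N0 \<le> n" for n
  proof -
    have "exp 1 \<le> real n" using exp_le n by simp
    hence "1 \<le> ln (real n)" using n by (subst ln_ge_iff) auto
    hence "\<bar>real n / ln (real n)\<bar> \<le> real n" using n by (simp add: field_simps mult_left_mono)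
    with N0[of n] n have "real (100 * ell n) \<le> real n" by simp
    hence "100 * ell n \<le> n" by (simp only: of_nat_le_iff)
    with n show ?thesis by (simp add: small_def)
  qed
  have "\<exists>LB. nvars (fst LB) = n \<and> valid_lp (fst LB) (snd LB) \<and>
      (small n \<longrightarrow> (\<forall>ss t. simplex_run (fst LB) P (snd LB) ss t \<longrightarrow> 2 ^ (n div 100) \<le> t))" for n
  proof (cases "small n")
    case True
    then obtain L B where "nvars L = n" "valid_lp L B"
      "\<And>ss t. simplex_run L P B ss t \<Longrightarrow> 2 ^ (n div 100) \<le> t"
      using exponential_lp[OF assms(2)] unfolding small_def by metis
    then show ?thesis by (intro exI[of _ "(L, B)"]) auto
  next
    case False
    then show ?thesis
      using valid_zero_lp by (intro exI[of _ "(zero_lp n, {})"]) (simp add: zero_lp_def)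
  qed
  then obtain LPs where LPs: "\<And>n. nvars (fst (LPs n)) = n" "\<And>n. valid_lp (fst (LPs n)) (snd (LPs n))"
    "\<And>n ss t. small n \<Longrightarrow> simplex_run (fst (LPs n)) P (snd (LPs n)) ss t \<Longrightarrow> 2 ^ (n div 100) \<le> t"
    by metis
  show ?thesis
  proof (intro exI[of _ LPs] conjI allI)
    fix k :: nat
    define b where "b = 100 * Suc k"
    show "\<exists>N. \<forall>n\<ge>N. \<forall>ss t. simplex_run (fst (LPs n)) P (snd (LPs n)) ss t \<longrightarrow> t \<ge> n ^ k"
    proof (intro exI[of _ "max (max 1000 N0) (b * b ^ k)"] allI impI)
      fix n ss t
      assume n: "max (max 1000 N0) (b * b ^ k) \<le> n"
        and run: "simplex_run (fst (LPs n)) P (snd (LPs n)) ss t"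
      have "n ^ k \<le> 2 ^ (n div 100)"
        using n by (intro power_le_two_power_div) (auto simp: b_def)
      also have "\<dots> \<le> t" using LPs(3)[OF small run] n by simp
      finally show "n ^ k \<le> t" .
    qed
  qed (use LPs in auto)
qed

end
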